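(* Let $k \geq 12$ be an integer with $k \equiv 0 \pmod 4$, and let $z_k$ be the zero of $E_k$ in $\mathbb{F}$ with the largest imaginary part. Then there exists a subsequence $\{n_t\}_{t=1}^\infty$ of $\{n\}_{n=1}^\infty$ such that \[ \lim_{t\to\infty} \frac{\beta_k(n_t)}{-q_{z_k}^{-n_t}\left(\frac{1}{\Theta(\mathrm{E}_k)(q_{z_k})} + \frac{1}{\Theta(\mathrm{E}_k)(\overline{q}_{z_k})}\left(\frac{q_{z_k}}{\overline{q}_{z_k}}\right)^{n_t}\right)} = 1. \]
   Context: For an even integer $k \geq 4$, $B_k$ is the $k$-th Bernoulli number, $\sigma_\ell(n)=\sum_{d\mid n}d^\ell$, and $\mathrm{E}_k(q) = 1 - \frac{2k}{B_k}\sum_{n\ge1}\sigma_{k-1}(n)q^n$; the Eisenstein series is $E_k(z) = \mathrm{E}_k(q_z)$ with $q_z = e^{2\pi i z}$ for $z$ in the upper half plane $\mathbb{H}$. $\beta_k(n)$ are the coefficients of the expansion of $1/\mathrm{E}_k(q)$ around $q=0$. The standard fundamental domain is $\mathbb{F} = \{z\in\mathbb{H} : |z|\ge 1,\ 0 \le \mathrm{Re}(z) \le 1/2\} \cup \{z \in \mathbb{H}: |z|>1,\ -1/2 < \mathrm{Re}(z) < 0\}$. $\overline{q}_{z_k}$ denotes the complex conjugate of $q_{z_k}$. $\Theta = q\frac{\mathrm d}{\mathrm dq}$ acts on power series by $\Theta(\sum a(n)q^n) = \sum n a(n) q^n$, and $\Theta(\mathrm{E}_k)(w)$ denotes the value of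 this power series at $q = w$. *)

theory Defs
  imports "HOL-Analysis.Analysis"
begin

text \<open>Generating function \<open>t / (exp t - 1) = (\<Sum>k. B\<^sub>k t^k / k!)\<close>, so \<open>B\<^sub>1 = -1/2\<close>.\<close>

definition bernoulli :: "nat \<Rightarrow> real" where
  "bernoulli k = fact k * fps_nth (fps_X / (fps_exp 1 - 1)) k"

definition divisor_sigma :: "nat \<Rightarrow> nat \<Rightarrow> nat" where
  "divisor_sigma l n = (\<Sum>d | d dvd n. d ^ l)"

text \<open>The \<open>q\<close>-series below are meant for even \<open>k \<ge> 4\<close>.\<close>

definition eisenstein_fps :: "nat \<Rightarrow> complex fps" where
  "eisenstein_fps k =
     1 - fps_const (complex_of_real (2 * real k / bernoulli k)) *
         Abs_fps (\<lambda>n. if n \<ge> 1 then of_nat (divisor_sigma (k - 1) n) else 0)"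

definition upper_half_plane :: "complex set" where
  "upper_half_plane = {z. Im z > 0}"

definition q_of :: "complex \<Rightarrow> complex" where
  "q_of z = exp (2 * of_real pi * \<i> * z)"

text \<open>The series has radius of convergence \<open>1\<close> and \<open>norm (q_of z) < 1\<close> exactly on the upper
  half plane, so this value is only meaningful there.\<close>

definition eisenstein :: "nat \<Rightarrow> complex \<Rightarrow> complex" where
  "eisenstein k z = eval_fps (eisenstein_fps k) (q_of z)"

definition inv_eisenstein_coeff :: "nat \<Rightarrow> nat \<Rightarrow> complex" where
  "inv_eisenstein_coeff k n = fps_nth (inverse (eisenstein_fps k)) n"

definition fundamental_domain :: "complex set" where
  "fundamental_domain =
     {z \<in> upper_half_plane. norm z \<ge> 1 \<and> 0 \<le> Re z \<and> Re z \<le> 1/2} \<union>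
     {z \<in> upper_half_plane. norm z > 1 \<and> -1/2 < Re z \<and> Re z < 0}"

text \<open>\<open>\<Theta> = q d/dq\<close> on power series is the library's \<^const>\<open>fps_XD\<close>.\<close>

definition theta_eisenstein :: "nat \<Rightarrow> complex \<Rightarrow> complex" where
  "theta_eisenstein k w = eval_fps (fps_XD (eisenstein_fps k)) w"

end

theory Submission
  imports Defs "HOL-Complex_Analysis.Complex_Analysis"
begin

text \<open>
  Summing over the lattice, \<open>2 \<zeta>(k) E\<^sub>k(z) = (\<Sum>(m, n) \<noteq> 0. (m z + n) powi (-k))\<close>; for \<open>z\<close> near the unit circle
  this is dominated by \<open>2 (1 + z powi (-k))\<close>. Writing \<open>z = \<i> exp (- \<i> t / k)\<close>, the main term becomes
  \<open>1 + exp (\<i> t)\<close>, so the highest zero belongs to the zero of \<open>1 + exp (\<i> t) + R t\<close> near \<open>t = \<pi>\<close>. The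
  remainder \<open>R\<close> has a small Lipschitz constant: the zero near \<open>\<pi>\<close> is therefore the unique fixed point
  of a contraction, it is simple, and by the symmetries of \<open>E\<^sub>k\<close> it is real. Elementary estimates show
  that, in the strip \<open>\<bar>Re z\<bar> \<le> 1 / 2\<close>, it and its mirror image are the only zeros of at least that height.

  Hence the only poles of \<open>1 / E\<^sub>k(q)\<close> in the closed disc through \<open>q = q_of z\<close> are simple ones at \<open>q\<close> and
  \<open>cnj q \<noteq> q\<close>, and subtracting their principal parts leaves an error \<open>o(norm q powi (-n))\<close> in the
  coefficients. The main term is of exact order \<open>norm q powi (-n)\<close> for at least one of any two
  consecutive \<open>n\<close>.
\<close>

section \<open>Polygamma functions, \<open>q\<close>-series and Bernoulli numbers\<close>

text \<open>The highest zero sits near t = pi because 1 + exp(it) vanishes at the odd multiples of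
  pi, while the arc point with real parameter t has height cos(t/k), which falls as t grows. The
  congruence on k enters through i^k = 1; for k = 2 mod 4 the highest zero is i itself, where q is
  real and the two poles merge. Simplicity of the zero is a genuine issue: E_8 = E_4^2 has a double
  one. Since E_k is given by its q-series and Bernoulli numbers by a generating function, the
  lattice formula has to be derived. Polygamma functions supply it, because bilateral sums of (z +
  n)^(-k) are derivatives of the cotangent. Numerical bounds are made for exponent 12 and carry over
  to k >= 12 because the lattice points in the remainder have modulus at least 1. Zeros are
  controlled in a whole strip and not just in the fundamental domain because a full disc in q
  corresponds to a full period, including points below the unit circle. The subsequence is there
  because the two principal parts have coefficients of equal modulus, so the main term may nearly
  cancel.\<close>

lemma higher_deriv_eq_of_chain:
  fixes F :: "nat \<Rightarrow> complex \<Rightarrow> complex"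
  assumes S: "open S"
    and F: "\<And>n z. z \<in> S \<Longrightarrow> (F n has_field_derivative F (Suc n) z) (at z)"
    and z: "z \<in> S"
  shows "(deriv ^^ n) (F 0) z = F n z"
  using z
proof (induction n arbitrary: z)
  case (Suc n)
  have "eventually (\<lambda>u. u \<in> S) (nhds z)"
    using S Suc.prems by (rule eventually_nhds_in_open)
  hence "eventually (\<lambda>u. (deriv ^^ n) (F 0) u = F n u) (nhds z)"
    by eventually_elim (rule Suc.IH)
  hence "deriv ((deriv ^^ n) (F 0)) z = deriv (F n) z"
    by (intro deriv_cong_ev) auto
  thus ?case using F[OF Suc.prems] by (simp add: DERIV_imp_deriv)
qed simp

text \<open>Differentiation kills the constant. This transfers the q-expansion of the cotangent,
  with its constant term, to all higher derivatives without computing any iterated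
  derivative.\<close>

lemma chain_eq_of_eq_const:
  fixes F G :: "nat \<Rightarrow> complex \<Rightarrow> complex"
  assumes S: "open S"
    and F: "\<And>n z. z \<in> S \<Longrightarrow> (F n has_field_derivative F (Suc n) z) (at z)"
    and G: "\<And>n z. z \<in> S \<Longrightarrow> (G n has_field_derivative G (Suc n) z) (at z)"
    and eq: "\<And>z. z \<in> S \<Longrightarrow> F 0 z = c + G 0 z"
    and z: "z \<in> S"
  shows "F (Suc n) z = G (Suc n) z"
proof -
  \<comment> \<open>Subtracting \<open>c\<close> at index 0 only makes \<open>H\<close> again a
    sequence of successive derivatives, with \<open>H 0\<close> identically zero on
    \<open>S\<close>.\<close>
  define H where "H = (\<lambda>n z. F n z - (if n = 0 then c else 0) - G n z)"
  have "(deriv ^^ Suc n) (H 0) z = H (Suc n) z"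
    by (rule higher_deriv_eq_of_chain[OF S _ z])
       (auto simp: H_def intro!: derivative_eq_intros F G)
  moreover have "(deriv ^^ Suc n) (\<lambda>_. 0) z = H' (Suc n) z"
    if "H' = (\<lambda>_ _. 0 :: complex)" for H'
    using higher_deriv_eq_of_chain[of S H' z "Suc n"] S z that by auto
  moreover have "(deriv ^^ Suc n) (H 0) z = (deriv ^^ Suc n) (\<lambda>_. 0) z"
  proof (rule higher_deriv_cong_ev)
    show "eventually (\<lambda>u. H 0 u = 0) (nhds z)"
      using eventually_nhds_in_open[OF S z] by eventually_elim (simp add: H_def eq)
  qed auto
  ultimately show ?thesis by (simp add: H_def)
qed

text \<open>Differentiate the reflection formula in two ways. The reciprocal \<open>rGamma\<close>
  is entire, so the product rule applies without any discussion of poles.\<close>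

lemma Digamma_reflection:
  fixes z :: complex
  assumes z: "z \<notin> \<int>"
  shows "Digamma (1 - z) - Digamma z = of_real pi * cos (of_real pi * z) / sin (of_real pi * z)"
proof -
  have nz: "z \<notin> \<int>\<^sub>\<le>\<^sub>0" "1 - z \<notin> \<int>\<^sub>\<le>\<^sub>0"
    using z by (auto elim!: nonpos_Ints_cases) (metis Ints_1 Ints_diff Ints_of_int diff_diff_eq2 add_diff_cancel_left')
  have eq: "(\<lambda>z. rGamma z * rGamma (1 - z)) = (\<lambda>z. sin (of_real pi * z) / of_real pi :: complex)"
    using rGamma_reflection_complex by auto
  have "((\<lambda>z. rGamma z * rGamma (1 - z)) has_field_derivative
          rGamma z * rGamma (1 - z) * (Digamma (1 - z) - Digamma z)) (at z)"
    using nz by (auto intro!: derivative_eq_intros simp: algebra_simps)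
  moreover have "((\<lambda>z. rGamma z * rGamma (1 - z)) has_field_derivative cos (of_real pi * z)) (at z)"
    unfolding eq by (auto intro!: derivative_eq_intros)
  ultimately have *: "rGamma z * rGamma (1 - z) * (Digamma (1 - z) - Digamma z) = cos (of_real pi * z)"
    by (rule DERIV_unique)
  have s: "sin (of_real pi * z) \<noteq> 0"
    using z by (auto simp: sin_eq_0)
  show ?thesis
    using * s unfolding rGamma_reflection_complex by (simp add: field_simps)
qed

section \<open>Power series in q and the derivatives of the cotangent\<close>

lemma q_of_power: "q_of z ^ n = q_of (of_nat n * z)"
  by (simp add: q_of_def flip: exp_of_nat_mult) (simp add: algebra_simps)

lemma norm_q_of: "norm (q_of z) = exp (- (2 * pi * Im z))"
  by (simp add: q_of_def)

lemma norm_q_of_less_1: "norm (q_of z) < 1 \<longleftrightarrow> Im z > 0"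
  by (simp add: norm_q_of zero_less_mult_iff)

lemma q_of_has_field_derivative:
  "(q_of has_field_derivative 2 * of_real pi * \<i> * q_of z) (at z within A)"
  unfolding q_of_def[abs_def] by (auto intro!: derivative_eq_intros)

text \<open>The polylogarithm of order -n. The guard on \<open>r\<close> removes the term 0^0 = 1
  that would otherwise appear for n = 0.\<close>

definition power_fps :: "nat \<Rightarrow> complex fps" where
  "power_fps n = Abs_fps (\<lambda>r. if r \<ge> 1 then of_nat r ^ n else 0)"

lemma fps_XD_power_fps: "fps_XD (power_fps n) = power_fps (Suc n)"
  by (rule fps_ext) (auto simp: power_fps_def fps_XD_nth)

lemma fps_conv_radius_XD:
  fixes f :: "'a :: {banach, real_normed_field} fps"
  shows "fps_conv_radius f \<le> fps_conv_radius (fps_XD f)"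
proof -
  have "fps_conv_radius f \<le> min (fps_conv_radius (fps_X :: 'a fps)) (fps_conv_radius (fps_deriv f))"
    using fps_conv_radius_deriv[of f] by simp
  also have "\<dots> \<le> fps_conv_radius (fps_XD f)"
    unfolding fps_XD_def o_def by (rule fps_conv_radius_mult)
  finally show ?thesis .
qed

lemma fps_conv_radius_power_fps: "fps_conv_radius (power_fps n) \<ge> 1"
proof (induction n)
  case 0
  have "conv_radius (fps_nth (power_fps 0)) \<ge> ereal 1"
  proof (rule conv_radius_geI_ex)
    fix r :: real assume "0 < r" "ereal r < ereal 1"
    hence "summable (\<lambda>n. (of_real r :: complex) ^ n)"
      by (intro summable_geometric) auto
    hence "summable (\<lambda>n. fps_nth (power_fps 0) n * (of_real r :: complex) ^ n)"
      by (subst (asm) summable_Suc_iff[symmetric], subst summable_Suc_iff[symmetric])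
         (simp add: power_fps_def)
    thus "\<exists>z. norm z = r \<and> summable (\<lambda>n. fps_nth (power_fps 0) n * z ^ n)"
      using \<open>0 < r\<close> by (intro exI[of _ "of_real r"]) auto
  qed
  thus ?case by (simp add: fps_conv_radius_def one_ereal_def)
next
  case (Suc n)
  thus ?case using fps_conv_radius_XD[of "power_fps n"] by (metis fps_XD_power_fps order_trans)
qed

lemma eval_fps_XD:
  fixes f :: "'a :: {banach, real_normed_field} fps"
  assumes "norm z < fps_conv_radius f"
  shows "eval_fps (fps_XD f) z = z * eval_fps (fps_deriv f) z"
  using assms fps_conv_radius_deriv[of f] 
  unfolding fps_XD_def o_def by (subst eval_fps_mult) (auto intro: less_le_trans)

lemma eval_fps_q_of_has_field_derivative:
  assumes f: "fps_conv_radius f \<ge> 1" and z: "Im z > 0"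
  shows "((\<lambda>z. eval_fps f (q_of z)) has_field_derivative 
            2 * of_real pi * \<i> * eval_fps (fps_XD f) (q_of z)) (at z within A)"
proof -
  have "ereal (norm (q_of z)) < 1"
    using z norm_q_of_less_1[of z] by simp
  hence *: "ereal (norm (q_of z)) < fps_conv_radius f" using f by (rule less_le_trans)
  show ?thesis
    using DERIV_chain2[OF has_field_derivative_eval_fps[OF *] q_of_has_field_derivative]
    by (simp add: eval_fps_XD[OF *] mult_ac)
qed

lemma eval_power_fps_0:
  assumes "norm q < 1"
  shows "eval_fps (power_fps 0) q = q / (1 - q)"
proof -
  have "(\<lambda>n. q * q ^ n) sums (q * (1 / (1 - q)))"
    by (intro sums_mult geometric_sums assms)
  moreover have "(\<lambda>n. fps_nth (power_fps 0) (Suc n) * q ^ Suc n) = (\<lambda>n. q * q ^ n)"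
    by (auto simp: power_fps_def)
  ultimately have "(\<lambda>n. fps_nth (power_fps 0) n * q ^ n) sums (q / (1 - q) + 0)"
    using sums_Suc_iff[of "\<lambda>n. fps_nth (power_fps 0) n * q ^ n" "q / (1 - q)"]
    by (simp add: power_fps_def)
  thus ?thesis unfolding eval_fps_def by (simp add: sums_iff)
qed

lemma cot_exp:
  fixes w :: complex
  assumes "sin w \<noteq> 0"
  shows "exp (2 * \<i> * w) \<noteq> 1" "cos w / sin w = \<i> + 2 * \<i> / (exp (2 * \<i> * w) - 1)"
proof -
  define e where "e = exp (\<i> * w)"
  have e: "e \<noteq> 0" "exp (- (\<i> * w)) = 1 / e" 
    by (auto simp: e_def exp_minus inverse_eq_divide)
  have q: "exp (2 * \<i> * w) = e\<^sup>2"
    by (simp add: e_def mult_ac flip: exp_double)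
  have s: "sin w = (e - 1 / e) / (2 * \<i>)" and c: "cos w = (e + 1 / e) / 2"
    unfolding sin_exp_eq cos_exp_eq e by (simp_all add: e_def)
  have n1: "e\<^sup>2 \<noteq> 1" using s assms e by (auto simp: field_simps power2_eq_square)
  thus "exp (2 * \<i> * w) \<noteq> 1" by (simp add: q)
  have "cos w / sin w = \<i> * (e\<^sup>2 + 1) / (e\<^sup>2 - 1)"
    unfolding s c using e(1) n1 by (simp add: divide_simps power2_eq_square)
  also have "\<dots> = \<i> + 2 * \<i> / (e\<^sup>2 - 1)"
    using n1 by (simp add: divide_simps) (auto simp: algebra_simps)
  finally show "cos w / sin w = \<i> + 2 * \<i> / (exp (2 * \<i> * w) - 1)" unfolding q .
qed

lemma cot_q_expansion:
  assumes z: "Im z > 0"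
  shows "of_real pi * cos (of_real pi * z) / sin (of_real pi * z) =
           - of_real pi * \<i> - 2 * of_real pi * \<i> * eval_fps (power_fps 0) (q_of z)"
proof -
  have n: "norm (q_of z) < 1" using z by (simp add: norm_q_of_less_1)
  hence n1: "q_of z \<noteq> 1" by auto
  have q: "exp (2 * \<i> * (of_real pi * z)) = q_of z"
    by (simp add: q_of_def mult_ac)
  have "z \<noteq> of_int n" for n
    using z by auto
  hence "sin (of_real pi * z) \<noteq> 0"
    by (auto simp: sin_eq_0)
  from cot_exp(2)[OF this] 
  have "cos (of_real pi * z) / sin (of_real pi * z) = \<i> + 2 * \<i> / (q_of z - 1)"
    unfolding q .
  also have "\<dots> = - \<i> - 2 * \<i> * (q_of z / (1 - q_of z))"
    using n1 by (simp add: divide_simps) (auto simp: algebra_simps)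
  finally have *: "cos (of_real pi * z) / sin (of_real pi * z) = - \<i> - 2 * \<i> * (q_of z / (1 - q_of z))" .
  have "of_real pi * cos (of_real pi * z) / sin (of_real pi * z) = 
          of_real pi * (cos (of_real pi * z) / sin (of_real pi * z))" by simp
  thus ?thesis
    unfolding eval_power_fps_0[OF n] * by (simp only: right_diff_distrib) (simp add: mult_ac)
qed

text \<open>The n-th derivative of the cotangent expansion: each differentiation produces a factor 2
  pi i from \<open>q_of\<close> and a sign from the argument 1 - z. For n > 0 the constant term of
  the cotangent has disappeared.\<close>

lemma Polygamma_q_expansion:
  assumes z: "Im z > 0" and n: "n > 0"
  shows "(-1) ^ n * Polygamma n (1 - z) - Polygamma n z =
           - ((2 * of_real pi * \<i>) ^ Suc n * eval_fps (power_fps n) (q_of z))"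
proof -
  define S where "S = {z. Im z > 0}"
  have S: "open S" unfolding S_def by (rule open_halfspace_Im_gt)
  have nz: "z \<notin> \<int>\<^sub>\<le>\<^sub>0" "1 - z \<notin> \<int>\<^sub>\<le>\<^sub>0" "z \<notin> \<int>" if "z \<in> S" for z
    using that by (auto simp: S_def elim!: nonpos_Ints_cases Ints_cases simp: complex_eq_iff)
  define F where "F = (\<lambda>n z. (-1) ^ n * Polygamma n (1 - z) - Polygamma n (z :: complex))"
  define G where "G = (\<lambda>n z. - ((2 * of_real pi * \<i>) ^ Suc n * eval_fps (power_fps n) (q_of z)))"
  have "F (Suc (n - 1)) z = G (Suc (n - 1)) z"
  proof (rule chain_eq_of_eq_const[OF S, where F = F and G = G and c = "- of_real pi * \<i>"])
    fix n z assume z: "z \<in> S"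
    show "(F n has_field_derivative F (Suc n) z) (at z)"
      unfolding F_def using nz[OF z] by (auto intro!: derivative_eq_intros)
    have "((\<lambda>z. eval_fps (power_fps n) (q_of z)) has_field_derivative
       2 * of_real pi * \<i> * eval_fps (power_fps (Suc n)) (q_of z)) (at z)"
      using z unfolding fps_XD_power_fps[symmetric] 
      by (intro eval_fps_q_of_has_field_derivative fps_conv_radius_power_fps) (auto simp: S_def)
    from DERIV_cmult[OF this, of "- ((2 * of_real pi * \<i>) ^ Suc n)"]
    show "(G n has_field_derivative G (Suc n) z) (at z)"
      unfolding G_def by (simp add: mult_ac)
  next
    fix z assume "z \<in> S"
    thus "F 0 z = - of_real pi * \<i> + G 0 z"
      using Digamma_reflection[of z] nz[of z] cot_q_expansion[of z] by (simp add: F_def G_def S_def)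
  next
    show "z \<in> S" using z by (simp add: S_def)
  qed
  thus ?thesis using n by (simp add: F_def G_def)
qed

section \<open>Bernoulli numbers and zeta values at even integers\<close>

lemma bernoulli_fps_mult:
  fixes c :: complex
  shows "Abs_fps (\<lambda>n. of_real (bernoulli n / fact n) * c ^ n) * (fps_exp c - 1) = fps_const c * fps_X"
proof -
  define B :: "real fps" where "B = fps_X / (fps_exp 1 - 1)"
  have "fps_nth (fps_exp 1 - 1 :: real fps) 1 \<noteq> 0" by simp
  hence nz: "fps_exp 1 - 1 \<noteq> (0 :: real fps)" by (metis fps_zero_nth)
  have sd: "subdegree (fps_exp 1 - 1 :: real fps) = 1"
    by (rule subdegreeI) auto
  \<comment> \<open>Division of formal power series is exact only under divisibility, which holds
    here because both series have subdegree 1.\<close>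
  have "(fps_exp 1 - 1 :: real fps) dvd fps_X"
    using nz by (subst fps_dvd_iff) (simp_all only: sd subdegree_fps_X le_refl fps_X_neq_zero not_False_eq_True)
  hence B: "B * (fps_exp 1 - 1) = fps_X" by (simp add: B_def)
  have nthB: "fps_nth B n = bernoulli n / fact n" for n by (simp add: B_def bernoulli_def)
  show ?thesis
  proof (rule fps_ext)
    fix n
    have "fps_nth (Abs_fps (\<lambda>n. of_real (bernoulli n / fact n) * c ^ n) * (fps_exp c - 1)) n =
       (\<Sum>i=0..n. of_real (fps_nth B i) * c ^ i * (of_real (fps_nth (fps_exp 1 - 1 :: real fps) (n - i)) * c ^ (n - i)))"
      unfolding fps_mult_nth nthB by (intro sum.cong) (auto simp: field_simps)
    also have "\<dots> = (\<Sum>i=0..n. of_real (fps_nth B i * fps_nth (fps_exp 1 - 1) (n - i)) * c ^ n)"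
      by (intro sum.cong refl) (auto simp: mult_ac simp flip: power_add)
    also have "\<dots> = of_real (fps_nth (B * (fps_exp 1 - 1)) n) * c ^ n"
      by (simp add: fps_mult_nth sum_distrib_right)
    also have "\<dots> = fps_nth (fps_const c * fps_X) n"
      unfolding B by (cases "n = 1") (auto simp: fps_X_nth)
    finally show "fps_nth (Abs_fps (\<lambda>n. of_real (bernoulli n / fact n) * c ^ n) * (fps_exp c - 1)) n = 
       fps_nth (fps_const c * fps_X) n" .
  qed
qed

text \<open>Euler's formula for zeta(k), the left side being zeta(k) for even k. It comes from
  expanding pi z cot(pi z) at 0 twice: through derivatives of \<open>Digamma\<close>, and through
  the Bernoulli generating function at 2 pi i z. The argument 1 + z replaces z to avoid the pole of
  \<open>Digamma\<close> at 0.\<close>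

lemma Polygamma_1_bernoulli:
  assumes k: "even k" "k \<ge> 2"
  shows "Polygamma (k - 1) (1 :: complex) / fact (k - 1) = 
           - (of_real (bernoulli k / fact k) * (2 * of_real pi * \<i>) ^ k / 2)"
proof -
  define c where "c = 2 * of_real pi * \<i>"
  define S where "S = ball (0::complex) 1"
  define F where "F = (\<lambda>n z. (-1) ^ n * Polygamma n (1 - z) - Polygamma n (1 + z :: complex))"
  have nz: "1 + z \<notin> \<int>\<^sub>\<le>\<^sub>0" "1 - z \<notin> \<int>\<^sub>\<le>\<^sub>0" if "z \<in> S" for z
  proof -
    have "\<bar>Re z\<bar> < 1" using that abs_Re_le_cmod[of z] by (simp add: S_def)
    thus "1 + z \<notin> \<int>\<^sub>\<le>\<^sub>0" "1 - z \<notin> \<int>\<^sub>\<le>\<^sub>0"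
      by (auto elim!: nonpos_Ints_cases simp: complex_eq_iff)
  qed
  have F': "(F n has_field_derivative F (Suc n) z) (at z)" if "z \<in> S" for n z
    unfolding F_def using nz[OF that] by (auto intro!: derivative_eq_intros)
  have hd: "(deriv ^^ n) (F 0) z = F n z" if "z \<in> S" for n z
    using that by (intro higher_deriv_eq_of_chain[of S] F') (auto simp: S_def)
  have "F 0 holomorphic_on S"
    by (rule holomorphic_onI) (use F' in \<open>auto simp: field_differentiable_def intro: has_field_derivative_at_within\<close>)
  hence "F 0 analytic_on S"
    by (subst analytic_on_open) (auto simp: S_def)
  hence "F 0 analytic_on {0}"
    by (rule analytic_on_subset) (auto simp: S_def)
  hence exp: "F 0 has_fps_expansion fps_expansion (F 0) 0"
    by (rule analytic_at_imp_has_fps_expansion_0)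
  define A where "A = fps_expansion (F 0) 0"
  \<comment> \<open>With F_0(z) = pi cot(pi z) - 1/z, this is the expansion of z F_0(z) + 1 - cz/2 =
    cz / (exp(cz) - 1), so its coefficients are B_n c^n / n!.\<close>
  define E where "E = fps_X * A + 1 - fps_const (c / 2) * fps_X"
  have Fz: "(z * F 0 z + 1 - c / 2 * z) * (exp (c * z) - 1) = c * z" if z: "z \<in> S" for z
  proof (cases "z = 0")
    case False
    have zi: "z \<notin> \<int>"
    proof
      assume "z \<in> \<int>"
      then obtain j where j: "z = of_int j" by (auto elim: Ints_cases)
      with z have "\<bar>j\<bar> < 1" by (simp add: S_def)
      with j False show False by simp
    qed
    have s: "sin (of_real pi * z) \<noteq> 0"
      using zi by (auto simp: sin_eq_0)
    have q: "exp (2 * \<i> * (of_real pi * z)) = exp (c * z)"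
      by (simp add: c_def mult_ac)
    note n1 = cot_exp(1)[OF s, unfolded q] and c = cot_exp(2)[OF s, unfolded q]
    have "Digamma (1 + z) = Digamma z + 1 / z"
      using Digamma_plus1[OF False] by (simp add: add.commute)
    hence "F 0 z = of_real pi * (cos (of_real pi * z) / sin (of_real pi * z)) - 1 / z"
      using Digamma_reflection[OF zi] by (simp add: F_def algebra_simps)
    hence "F 0 z = of_real pi * (\<i> + 2 * \<i> / (exp (c * z) - 1)) - 1 / z"
      unfolding c .
    thus ?thesis using n1 False by (simp add: c_def field_simps)
  qed auto
  have ev: "eventually (\<lambda>z. z \<in> S) (nhds 0)"
    by (rule eventually_nhds_in_open) (auto simp: S_def)
  have "(\<lambda>z. (z * F 0 z + 1 - c / 2 * z) * (exp (c * z) - 1)) has_fps_expansion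
           E * (fps_exp c - 1)"
    unfolding E_def A_def by (intro fps_expansion_intros exp)
  moreover have "eventually (\<lambda>z. (z * F 0 z + 1 - c / 2 * z) * (exp (c * z) - 1) = c * z) (nhds 0)"
    using ev by eventually_elim (rule Fz)
  ultimately have "(\<lambda>z. c * z) has_fps_expansion E * (fps_exp c - 1)"
    unfolding has_fps_expansion_def by (auto elim: eventually_elim2)
  moreover have "(\<lambda>z. c * z) has_fps_expansion fps_const c * fps_X"
    by (intro fps_expansion_intros)
  ultimately have "E * (fps_exp c - 1) = fps_const c * fps_X"
    by (rule fps_expansion_unique_complex)
  also have "\<dots> = Abs_fps (\<lambda>n. of_real (bernoulli n / fact n) * c ^ n) * (fps_exp c - 1)"
    by (rule bernoulli_fps_mult [symmetric])
  finally have "E = Abs_fps (\<lambda>n. of_real (bernoulli n / fact n) * c ^ n)"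
  proof (subst (asm) mult_cancel_right, elim disjE)
    assume "fps_exp c - 1 = 0"
    hence "fps_nth (fps_exp c - 1) 1 = 0" by simp
    thus ?thesis by (simp add: c_def)
  qed auto
  hence "fps_nth E k = of_real (bernoulli k / fact k) * c ^ k" by simp
  moreover have "fps_nth E k = fps_nth A (k - 1)"
    using k by (auto simp: E_def fps_X_nth)
  moreover have "fps_nth A (k - 1) = - 2 * Polygamma (k - 1) 1 / fact (k - 1)"
  proof -
    have "fps_nth A (k - 1) = (deriv ^^ (k - 1)) (F 0) 0 / fact (k - 1)"
      unfolding A_def by (rule fps_nth_fps_expansion[OF exp])
    also have "(deriv ^^ (k - 1)) (F 0) 0 = - 2 * Polygamma (k - 1) 1"
      using k by (subst hd) (auto simp: S_def F_def)
    finally show ?thesis .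
  qed
  ultimately have "- 2 * (Polygamma (k - 1) 1 / fact (k - 1)) = of_real (bernoulli k / fact k) * c ^ k"
    by simp
  moreover have "a = - (b / 2)" if "- 2 * a = b" for a b :: complex
    using that by auto
  ultimately show ?thesis unfolding c_def by blast
qed

section \<open>Lattice sums\<close>

lemma summable_on_intI:
  fixes f :: "int \<Rightarrow> real"
  assumes "(\<lambda>n::nat. f (int n)) summable_on UNIV" "(\<lambda>n::nat. f (- int n)) summable_on UNIV"
  shows "f summable_on UNIV"
proof -
  have "f summable_on range int"
    by (subst summable_on_reindex) (use assms in \<open>auto simp: o_def\<close>)
  moreover have "f summable_on range (\<lambda>n. - int n)"
    by (subst summable_on_reindex) (use assms in \<open>auto simp: o_def inj_on_def\<close>)
  ultimately have "f summable_on (range int \<union> range (\<lambda>n. - int n))"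
    by (rule summable_on_union)
  also have "range int \<union> range (\<lambda>n. - int n) = UNIV"
    by (auto simp: image_iff) (metis int_cases2)
  finally show ?thesis .
qed

lemma summable_on_int_inverse_square: "(\<lambda>n::int. 1 / (1 + (of_int n)\<^sup>2) :: real) summable_on UNIV"
proof -
  have "summable (\<lambda>n. 1 / (1 + (real n)\<^sup>2))"
  proof (rule summable_comparison_test)
    show "summable (\<lambda>n. inverse (real n ^ 2))"
      by (rule inverse_power_summable) auto
    show "\<exists>N. \<forall>n\<ge>N. norm (1 / (1 + (real n)\<^sup>2)) \<le> inverse (real n ^ 2)"
      by (intro exI[of _ 1]) (auto simp: divide_simps add_pos_nonneg)
  qed
  hence "(\<lambda>n. 1 / (1 + (real n)\<^sup>2)) summable_on UNIV"
    by (subst summable_on_UNIV_nonneg_real_iff) (auto intro: add_nonneg_nonneg)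
  thus ?thesis by (intro summable_on_intI) simp_all
qed

lemma summable_on_real_product:
  fixes f :: "'a \<Rightarrow> real" and g :: "'b \<Rightarrow> real"
  assumes f: "f summable_on A" and g: "g summable_on B"
    and nonneg: "\<And>x. x \<in> A \<Longrightarrow> f x \<ge> 0" "\<And>y. y \<in> B \<Longrightarrow> g y \<ge> 0"
  shows "(\<lambda>(x, y). f x * g y) summable_on A \<times> B"
proof (rule summable_on_SigmaI)
  show "((\<lambda>y. case (x, y) of (x, y) \<Rightarrow> f x * g y) has_sum (f x * infsum g B)) B" for x
    using g by (auto intro!: has_sum_cmult_right has_sum_infsum)
  show "(\<lambda>x. f x * infsum g B) summable_on A"
    using f by (rule summable_on_cmult_left)
qed (use nonneg in auto)

text \<open>At the origin the junk value \<open>1 / 0 = 0\<close> lets the lattice sums range over all of \<open>UNIV\<close>.\<close>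

definition lattice_term :: "nat \<Rightarrow> complex \<Rightarrow> int \<times> int \<Rightarrow> complex" where
  "lattice_term k z = (\<lambda>(m, n). 1 / (of_int m * z + of_int n) ^ k)"

lemma norm_lattice_point:
  "(norm (of_int m * z + of_int n))\<^sup>2 = (of_int m * Re z + of_int n)\<^sup>2 + (of_int m * Im z)\<^sup>2"
  by (simp add: cmod_def)

text \<open>The quadratic form |mz + n|^2 is definite, so it dominates m^2 + n^2 up to the factor
  \<open>C\<close>. Four of the k powers pay for the summable product of 1/(1 + m^2) and 1/(1 +
  n^2); the other k - 4 are absorbed by \<open>d\<close>, a lower bound for the modulus of nonzero
  lattice points.\<close>

lemma lattice_summable:
  assumes z: "Im z > 0" and k: "k \<ge> 4"
  shows "(\<lambda>p. norm (lattice_term k z p)) summable_on UNIV"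
proof -
  define C where "C = 2 + (1 + 2 * (Re z)\<^sup>2) / (Im z)\<^sup>2"
  have C: "C > 0" unfolding C_def using z by (intro add_pos_nonneg) auto
  have le_C: "(of_int m)\<^sup>2 + (of_int n)\<^sup>2 \<le> C * (norm (of_int m * z + of_int n))\<^sup>2" for m n :: int
  proof -
    define a b where "a = of_int m * Re z + of_int n" and "b = of_int m * Im z"
    have m: "of_int m = b / Im z" and n: "of_int n = a - b / Im z * Re z"
      using z by (auto simp: a_def b_def)
    have "(of_int n)\<^sup>2 \<le> 2 * a\<^sup>2 + 2 * (b / Im z * Re z)\<^sup>2"
      unfolding n using sum_power2_ge_zero[of "a + b / Im z * Re z" 0] by (simp add: power2_sum power2_diff)
    hence "(of_int m)\<^sup>2 + (of_int n)\<^sup>2 \<le> 2 * a\<^sup>2 + (1 + 2 * (Re z)\<^sup>2) / (Im z)\<^sup>2 * b\<^sup>2"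
      unfolding m by (simp add: power_mult_distrib power_divide add_divide_distrib distrib_left distrib_right mult_ac)
    also have "\<dots> \<le> C * a\<^sup>2 + C * b\<^sup>2"
      unfolding C_def by (intro add_mono mult_right_mono) auto
    also have "\<dots> = C * (norm (of_int m * z + of_int n))\<^sup>2"
      by (simp add: norm_lattice_point a_def b_def distrib_left)
    finally show ?thesis .
  qed
  define d where "d = 1 / sqrt C"
  have d: "d > 0" using C by (simp add: d_def)
  have bound: "norm (lattice_term k z (m, n)) \<le> 
                 4 * C\<^sup>2 / d ^ (k - 4) * ((1 / (1 + (of_int m)\<^sup>2)) * (1 / (1 + (of_int n)\<^sup>2)))" for m n
  proof (cases "m = 0 \<and> n = 0")
    case True
    thus ?thesis using k d by (simp add: lattice_term_def power_0_left)
  next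
    case False
    define N where "N = norm (of_int m * z + of_int n)"
    define Q :: real where "Q = (of_int m)\<^sup>2 + (of_int n)\<^sup>2"
    have "m\<^sup>2 + n\<^sup>2 > 0" using False
      by (simp add: sum_power2_gt_zero_iff)
    hence "m\<^sup>2 + n\<^sup>2 \<ge> 1" by linarith
    hence Q1: "Q \<ge> 1" unfolding Q_def
      by (simp flip: of_int_power of_int_add)
    have QN: "Q \<le> C * N\<^sup>2" unfolding Q_def N_def by (rule le_C)
    have N0: "N \<ge> 0" by (simp add: N_def)
    have "1 / C \<le> N\<^sup>2" using order_trans[OF Q1 QN] C by (simp add: pos_divide_le_eq mult.commute)
    moreover have "d\<^sup>2 = 1 / C" unfolding d_def using C by (simp add: power_divide)
    ultimately have "d\<^sup>2 \<le> N\<^sup>2" by (simp only:)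
    hence dN: "d \<le> N" using N0 by (rule power2_le_imp_le)
    hence N: "N > 0" using d by linarith
    have "(1 + (of_int m)\<^sup>2) * (1 + (of_int n)\<^sup>2) \<le> (2 * Q) * (2 * Q)"
    proof (intro mult_mono)
      have *: "1 + a \<le> 2 * Q" if "Q = a + b" "a \<ge> 0" "b \<ge> 0" for a b
        using that Q1 by linarith
      show "1 + (of_int m)\<^sup>2 \<le> 2 * Q" by (rule *[OF Q_def]) auto
      show "1 + (of_int n)\<^sup>2 \<le> 2 * Q" by (rule *[OF Q_def[THEN trans, OF add.commute]]) auto
    qed (use Q1 in auto)
    also have "\<dots> \<le> (2 * (C * N\<^sup>2)) * (2 * (C * N\<^sup>2))"
      using QN Q1 by (intro mult_mono) auto
    finally have P: "(1 + (of_int m)\<^sup>2) * (1 + (of_int n)\<^sup>2) \<le> 4 * C\<^sup>2 * N ^ 4"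
      by (simp add: power2_eq_square power4_eq_xxxx mult_ac)
    have pos: "(1 + (of_int m)\<^sup>2) * (1 + (of_int n)\<^sup>2) > (0::real)"
      by (intro mult_pos_pos add_pos_nonneg) auto
    have "d ^ (k - 4) * ((1 + (of_int m)\<^sup>2) * (1 + (of_int n)\<^sup>2)) \<le> N ^ (k - 4) * (4 * C\<^sup>2 * N ^ 4)"
      using N by (intro mult_mono[OF power_mono[OF dN less_imp_le[OF d]] P] less_imp_le[OF pos]) auto
    also have "\<dots> = 4 * C\<^sup>2 * N ^ k"
      using k by (simp add: mult_ac flip: power_add)
    finally have "d ^ (k - 4) * ((1 + (of_int m)\<^sup>2) * (1 + (of_int n)\<^sup>2)) \<le> 4 * C\<^sup>2 * N ^ k" .
    hence "1 / N ^ k \<le> 4 * C\<^sup>2 / (d ^ (k - 4) * ((1 + (of_int m)\<^sup>2) * (1 + (of_int n)\<^sup>2)))"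
      using N d mult_pos_pos[OF zero_less_power[OF d, of "k - 4"] pos]
      by (simp add: pos_le_divide_eq pos_divide_le_eq mult.commute)
    thus ?thesis
      by (simp add: lattice_term_def norm_divide norm_power N_def)
  qed
  show ?thesis
  proof (rule Infinite_Sum.abs_summable_on_comparison_test')
    have "(\<lambda>(m::int, n::int). (1 / (1 + (of_int m)\<^sup>2)) * (1 / (1 + (of_int n)\<^sup>2)) :: real) summable_on UNIV \<times> UNIV"
      by (intro summable_on_real_product summable_on_int_inverse_square) (auto intro: add_nonneg_nonneg)
    hence "(\<lambda>p. 4 * C\<^sup>2 / d ^ (k - 4) * (case p of (m::int, n::int) \<Rightarrow>
             (1 / (1 + (of_int m)\<^sup>2)) * (1 / (1 + (of_int n)\<^sup>2)))) summable_on UNIV \<times> UNIV"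
      by (rule summable_on_cmult_right)
    thus "(\<lambda>p. 4 * C\<^sup>2 / d ^ (k - 4) * (case p of (m::int, n::int) \<Rightarrow>
             (1 / (1 + (of_int m)\<^sup>2)) * (1 / (1 + (of_int n)\<^sup>2)))) summable_on UNIV"
      by simp
    show "norm (lattice_term k z p) \<le> 4 * C\<^sup>2 / d ^ (k - 4) * (case p of (m, n) \<Rightarrow>
             (1 / (1 + (of_int m)\<^sup>2)) * (1 / (1 + (of_int n)\<^sup>2)))" for p
      by (cases p) (use bound in simp)
  qed
qed

lemma lattice_summable': "Im z > 0 \<Longrightarrow> k \<ge> 4 \<Longrightarrow> lattice_term k z summable_on A"
  by (rule summable_on_subset[OF _ subset_UNIV]) (rule abs_summable_summable[OF lattice_summable])

definition lattice_sum :: "nat \<Rightarrow> complex \<Rightarrow> complex" where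
  "lattice_sum k z = infsum (lattice_term k z) UNIV"

text \<open>The identity m(-1/z) + n = (nz - m)/z turns inversion into the permutation (m, n) -> (n,
  -m) of the lattice.\<close>

lemma lattice_sum_inversion:
  assumes "Im z > 0"
  shows "lattice_sum k (- 1 / z) = z ^ k * lattice_sum k z"
proof -
  have z: "z \<noteq> 0" using assms by auto
  have "lattice_sum k (- 1 / z) = (\<Sum>\<^sub>\<infinity>p. z ^ k * lattice_term k z p)"
    unfolding lattice_sum_def
  proof (rule infsum_reindex_bij_witness[of _ "\<lambda>(m, n). (- n, m)" "\<lambda>(m, n). (n, - m)"])
    fix p :: "int \<times> int"
    obtain m n where p: "p = (m, n)" by force
    have "of_int m * (- 1 / z) + of_int n = (of_int n * z + of_int (- m)) / z"
      using z by (simp add: field_simps)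
    thus "z ^ k * lattice_term k z (case p of (m, n) \<Rightarrow> (n, - m)) = lattice_term k (- 1 / z) p"
      by (simp add: p lattice_term_def power_divide)
  qed auto
  thus ?thesis by (simp add: infsum_cmult_right' lattice_sum_def)
qed

text \<open>The reflection changes mz + n into minus the conjugate of mz - n; an even exponent
  absorbs the sign.\<close>

lemma lattice_sum_cnj: "lattice_sum k (- cnj z) = cnj (lattice_sum k z)" if "even k"
proof -
  have "lattice_sum k (- cnj z) = (\<Sum>\<^sub>\<infinity>p. cnj (lattice_term k z p))"
    unfolding lattice_sum_def
  proof (rule infsum_reindex_bij_witness[of _ "\<lambda>(m, n). (m, - n)" "\<lambda>(m, n). (m, - n)"])
    fix p :: "int \<times> int"
    obtain m n where p: "p = (m, n)" by force
    have "(- of_int m * cnj z + of_int n) ^ k = (- (of_int m * cnj z + of_int (- n))) ^ k"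
      by simp
    also have "\<dots> = (of_int m * cnj z + of_int (- n)) ^ k"
      using that by (rule power_minus_even)
    finally show "cnj (lattice_term k z (case p of (m, n) \<Rightarrow> (m, - n))) = lattice_term k (- cnj z) p"
      by (simp add: p lattice_term_def)
  qed auto
  thus ?thesis by (simp add: lattice_sum_def)
qed

text \<open>One representative of each pair of opposite nonzero lattice points.\<close>

definition half_lattice :: "(int \<times> int) set" where
  "half_lattice = {0} \<times> {1..} \<union> {1..} \<times> UNIV"

lemma lattice_sum_half:
  assumes z: "Im z > 0" and k: "k \<ge> 4" "even k"
  shows "lattice_sum k z = 2 * infsum (lattice_term k z) half_lattice"
proof -
  define f where "f = lattice_term k z"
  define H' where "H' = (\<lambda>(m, n). (- m, - n)) ` half_lattice"
  have sum: "f summable_on A" for A unfolding f_def using z k by (intro lattice_summable')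
  have "infsum f H' = infsum (f \<circ> (\<lambda>(m, n). (- m, - n))) half_lattice"
    unfolding H'_def by (rule infsum_reindex) (auto simp: inj_on_def)
  also have "f \<circ> (\<lambda>(m, n). (- m, - n)) = f"
  proof
    fix p :: "int \<times> int"
    obtain m n where p: "p = (m, n)" by force
    have "of_int (- m) * z + of_int (- n) = - (of_int m * z + of_int n)"
      by simp
    moreover have "(- (of_int m * z + of_int n)) ^ k = (of_int m * z + of_int n) ^ k"
      using k by (intro power_minus_even)
    ultimately show "(f \<circ> (\<lambda>(m, n). (- m, - n))) p = f p"
      by (simp only: p f_def lattice_term_def o_def case_prod_conv)
  qed
  finally have H': "infsum f H' = infsum f half_lattice" .
  have "UNIV = insert (0, 0) (half_lattice \<union> H')"
  proof safe
    fix m n :: int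
    assume *: "(m, n) \<notin> H'" "(m, n) \<notin> half_lattice"
    have "(- m, - n) \<notin> half_lattice"
      using *(1) unfolding H'_def by (metis (mono_tags, lifting) case_prod_conv image_eqI minus_minus)
    thus "m = 0" "n = 0" using *(2) by (auto simp: half_lattice_def)
  qed auto
  hence "infsum f UNIV = infsum f (insert (0, 0) (half_lattice \<union> H'))" by simp
  also have "\<dots> = f (0, 0) + infsum f (half_lattice \<union> H')"
    by (rule infsum_insert[OF sum]) (auto simp: half_lattice_def H'_def)
  also have "f (0, 0) = 0" using k by (simp add: f_def lattice_term_def)
  also have "infsum f (half_lattice \<union> H') = infsum f half_lattice + infsum f H'"
    by (rule infsum_Un_disjoint) (auto simp: sum half_lattice_def H'_def)
  finally show ?thesis using H' by (simp add: f_def lattice_sum_def)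
qed

section \<open>The Eisenstein series as a lattice sum\<close>

text \<open>Lipschitz's formula. The nonnegative n give a Polygamma value at z, the negative n one
  at 1 - z; since k - 1 is odd, their combination is the one with a known q-expansion.\<close>

lemma has_sum_shifted_inverse_powers:
  assumes z: "Im z > 0" and k: "even k" "k \<ge> 4"
  shows "((\<lambda>n::int. 1 / (z + of_int n) ^ k) has_sum
           ((2 * of_real pi * \<i>) ^ k / fact (k - 1) * eval_fps (power_fps (k - 1)) (q_of z))) UNIV"
proof -
  define f where "f = (\<lambda>n::int. 1 / (z + of_int n) ^ k)"
  have nz: "z \<noteq> 0" "1 - z \<noteq> 0" using z by auto
  have k1: "Suc (k - 1) = k" "odd (k - 1)" using k by auto
  \<comment> \<open>Summability is inherited from the row m = 1 of the lattice sum.\<close>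
  have "lattice_term k z summable_on (Pair 1 ` UNIV)"
    using z k by (intro lattice_summable')
  hence "f summable_on UNIV"
    by (subst (asm) summable_on_reindex) (auto simp: inj_on_def o_def lattice_term_def f_def)
  hence sum: "f summable_on A" for A
    by (rule summable_on_subset) auto
  have "(f has_sum infsum f (range int)) (range int)" using sum by (rule has_sum_infsum)
  hence "((\<lambda>n. f (int n)) has_sum infsum f (range int)) UNIV"
    by (subst (asm) has_sum_reindex) (auto simp: o_def)
  hence "(\<lambda>n. f (int n)) sums infsum f (range int)" by (rule has_sum_imp_sums)
  moreover have "(\<lambda>n. f (int n)) sums (Polygamma (k - 1) z / fact (k - 1))"
    using Polygamma_LIMSEQ[OF nz(1), of "k - 1"] k k1 by (simp add: f_def inverse_eq_divide)
  ultimately have 1: "infsum f (range int) = Polygamma (k - 1) z / fact (k - 1)"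
    by (rule sums_unique2)
  \<comment> \<open>An enumeration of the negative integers with z + h(n) = -(1 - z + n), so that
    the even power sees 1 - z + n.\<close>
  define h where "h = (\<lambda>n. - int n - 1)"
  have "(f has_sum infsum f (range h)) (range h)" using sum by (rule has_sum_infsum)
  hence "((\<lambda>n. f (h n)) has_sum infsum f (range h)) UNIV"
    by (subst (asm) has_sum_reindex) (auto simp: o_def inj_on_def h_def)
  hence "(\<lambda>n. f (h n)) sums infsum f (range h)" by (rule has_sum_imp_sums)
  moreover have "f (h n) = 1 / (1 - z + of_nat n) ^ k" for n
  proof -
    have "z + of_int (h n) = - (1 - z + of_nat n)" by (simp add: h_def)
    thus ?thesis unfolding f_def using k by (metis power_minus_even)
  qed
  hence "(\<lambda>n. f (h n)) sums (Polygamma (k - 1) (1 - z) / fact (k - 1))"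
    using Polygamma_LIMSEQ[OF nz(2), of "k - 1"] k k1 by (simp add: inverse_eq_divide)
  ultimately have 2: "infsum f (range h) = Polygamma (k - 1) (1 - z) / fact (k - 1)"
    by (rule sums_unique2)
  have "x \<in> range int \<union> range h" for x :: int
  proof (cases "x \<ge> 0")
    case True
    thus ?thesis by (auto intro!: image_eqI[of _ _ "nat x"])
  next
    case False
    thus ?thesis by (auto simp: h_def intro!: image_eqI[of _ _ "nat (- x - 1)"])
  qed
  hence "UNIV = range int \<union> range h" by auto
  hence "infsum f UNIV = infsum f (range int \<union> range h)" by simp
  also have "\<dots> = infsum f (range int) + infsum f (range h)"
    by (rule infsum_Un_disjoint) (auto simp: sum h_def)
  also have "\<dots> = - (((-1) ^ (k - 1) * Polygamma (k - 1) (1 - z) - Polygamma (k - 1) z) / fact (k - 1))"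
    unfolding 1 2 using k1 by (simp add: field_simps)
  also have "\<dots> = (2 * of_real pi * \<i>) ^ k / fact (k - 1) * eval_fps (power_fps (k - 1)) (q_of z)"
    using k k1(1) by (subst Polygamma_q_expansion[OF z]) auto
  finally show ?thesis using sum[of UNIV] unfolding f_def[symmetric] by (simp add: has_sum_iff)
qed

text \<open>Identifies the Polygamma value at 1 with zeta(k); in this form Euler's formula can be
  inserted into the lattice sum.\<close>

lemma has_sum_zeta:
  assumes k: "even k" "k \<ge> 2"
  shows "((\<lambda>n::int. 1 / of_int n ^ k) has_sum (Polygamma (k - 1) 1 / fact (k - 1) :: complex)) {1..}"
proof -
  define h where "h = (\<lambda>n. 1 + int n)"
  have k1: "Suc (k - 1) = k" "odd (k - 1)" using k by auto
  have "((\<lambda>n. 1 / of_int (h n) ^ k) has_sum (Polygamma (k - 1) 1 / fact (k - 1) :: complex)) UNIV"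
  proof (rule norm_summable_imp_has_sum)
    show "(\<lambda>n. 1 / of_int (h n) ^ k) sums (Polygamma (k - 1) 1 / fact (k - 1) :: complex)"
      using Polygamma_LIMSEQ[of 1 "k - 1"] k k1 by (simp add: inverse_eq_divide h_def)
    have "summable (\<lambda>n. inverse (real (Suc n) ^ k))"
      using k by (subst summable_Suc_iff) (rule inverse_power_summable)
    also have "(\<lambda>n. inverse (real (Suc n) ^ k)) = (\<lambda>n. norm (1 / of_int (h n) ^ k :: complex))"
      by (auto simp: h_def norm_divide norm_power inverse_eq_divide norm_of_nat[of "Suc _", simplified] 
               simp del: of_nat_Suc simp flip: of_nat_Suc)
    finally show "summable (\<lambda>n. norm (1 / of_int (h n) ^ k :: complex))" .
  qed
  hence "((\<lambda>n. 1 / of_int n ^ k) has_sum (Polygamma (k - 1) 1 / fact (k - 1) :: complex)) (range h)"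
    by (subst has_sum_reindex) (auto simp: o_def inj_on_def h_def)
  also have "range h = {1..}"
  proof safe
    fix x :: int assume "x \<ge> 1"
    thus "x \<in> range h" by (intro image_eqI[of _ _ "nat (x - 1)"]) (auto simp: h_def)
  qed (auto simp: h_def)
  finally show ?thesis .
qed

section \<open>Lambert series of the divisor sums\<close>

definition sigma_fps :: "nat \<Rightarrow> complex fps" where
  "sigma_fps j = Abs_fps (\<lambda>n. if n \<ge> 1 then of_nat (divisor_sigma j n) else 0)"

lemma norm_less_fps_conv_radius:
  assumes "norm q < 1" "fps_conv_radius f \<ge> 1"
  shows "ereal (norm q) < fps_conv_radius f"
proof -
  have "ereal (norm q) < 1" using assms(1) by simp
  thus ?thesis using assms(2) by (rule less_le_trans)
qed

lemma has_sum_power_fps: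
  assumes q: "norm q < 1"
  shows "((\<lambda>r. of_nat r ^ j * q ^ r) has_sum eval_fps (power_fps j) q) {1..}"
proof -
  have *: "ereal (norm q) < fps_conv_radius (power_fps j)"
    using q fps_conv_radius_power_fps by (rule norm_less_fps_conv_radius)
  have "((\<lambda>r. fps_nth (power_fps j) r * q ^ r) has_sum eval_fps (power_fps j) q) UNIV"
    by (intro norm_summable_imp_has_sum norm_summable_fps sums_eval_fps *)
  thus ?thesis
    by (rule has_sum_cong_neutral[THEN iffD1, rotated -1]) (auto simp: power_fps_def)
qed

text \<open>The double series of r^j q^(mr) over m, r >= 1 converges absolutely. Summing over r
  first gives the left side, and collecting the terms with mr = n gives the divisor sums.\<close>

lemma lambert_series:
  assumes q: "norm q < 1"
  shows "((\<lambda>m. eval_fps (power_fps j) (q ^ m)) has_sum eval_fps (sigma_fps j) q) {1..}"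
    and "(\<lambda>n. fps_nth (sigma_fps j) n * q ^ n) sums eval_fps (sigma_fps j) q"
proof -
  define x where "x = norm q"
  have x: "0 \<le> x" "x < 1" using q by (auto simp: x_def)
  define F where "F = (\<lambda>(m, r). of_nat r ^ j * q ^ (m * r))"
  have "(\<lambda>p. norm (F p)) summable_on ({1..} \<times> {1..})"
  proof (rule Infinite_Sum.abs_summable_on_comparison_test')
    have "(\<lambda>m. x ^ (m - 1)) summable_on {1..}"
    proof -
      have "(\<lambda>m. x ^ m) summable_on UNIV"
        using x by (subst summable_on_UNIV_nonneg_real_iff) (auto intro: summable_geometric)
      hence "(\<lambda>m. x ^ (m - 1)) summable_on range Suc"
        by (subst summable_on_reindex) (auto simp: o_def)
      thus ?thesis by (simp add: atLeast_Suc_greaterThan greaterThan_0)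
    qed
    moreover have "(\<lambda>r. real r ^ j * x ^ r) summable_on {1..}"
    proof -
      have "norm (of_real x :: complex) < 1" using x by simp
      from has_sum_Re[OF has_sum_power_fps[OF this, of j]]
      have "(\<lambda>r. Re (of_nat r ^ j * of_real x ^ r)) summable_on {1..}"
        by (rule has_sum_imp_summable)
      moreover have "of_nat r ^ j * of_real x ^ r = complex_of_real (real r ^ j * x ^ r)" for r
        by simp
      ultimately show ?thesis by (simp only: Re_complex_of_real)
    qed
    ultimately have "(\<lambda>(m, r). x ^ (m - 1) * (real r ^ j * x ^ r)) summable_on {1..} \<times> {1..}"
      using x by (intro summable_on_real_product) auto
    thus "(\<lambda>(m, r). x ^ (m - 1) * (real r ^ j * x ^ r)) summable_on {1..} \<times> {1..}" .
  next
    fix p :: "nat \<times> nat" assume p: "p \<in> {1..} \<times> {1..}"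
    then obtain m r where mr: "p = (Suc m, Suc r)"
      by (cases p) (auto simp: Suc_le_eq gr0_conv_Suc)
    \<comment> \<open>For m, r >= 1 one has mr >= (m - 1) + r, which lets the majorant factor into a
      function of m times a function of r.\<close>
    have "x ^ (Suc m * Suc r) \<le> x ^ (m + Suc r)"
      using x by (intro power_decreasing) auto
    hence "real (Suc r) ^ j * x ^ (Suc m * Suc r) \<le> real (Suc r) ^ j * x ^ (m + Suc r)"
      by (rule mult_left_mono) auto
    moreover have "norm (F p) = real (Suc r) ^ j * x ^ (Suc m * Suc r)"
      unfolding mr F_def case_prod_conv norm_mult norm_power norm_of_nat x_def ..
    ultimately show "norm (F p) \<le> (case p of (m, r) \<Rightarrow> x ^ (m - 1) * (real r ^ j * x ^ r))"
      unfolding mr by (simp add: power_add mult_ac del: of_nat_Suc)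
  qed
  hence "F summable_on ({1..} \<times> {1..})" by (rule abs_summable_summable)
  then obtain T where T: "(F has_sum T) ({1..} \<times> {1..})" by (auto simp: summable_on_def)
  have 1: "((\<lambda>m. eval_fps (power_fps j) (q ^ m)) has_sum T) {1..}"
  proof (rule has_sum_SigmaD[OF T])
    fix m :: nat assume "m \<in> {1..}"
    hence "norm (q ^ m) < 1" using q by (simp add: norm_power power_less_one_iff)
    from has_sum_power_fps[OF this, of j]
    show "((\<lambda>r. F (m, r)) has_sum eval_fps (power_fps j) (q ^ m)) {1..}"
      by (simp add: F_def power_mult)
  qed
  have "((\<lambda>(n, d). of_nat d ^ j * q ^ n) has_sum T) (Sigma {1..} (\<lambda>n. {d. d dvd n}))"
    using T
  proof (subst has_sum_reindex_bij_witness[of _ "\<lambda>(m, r). (m * r, r)" "\<lambda>(n, d). (n div d, d)"])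
    show "(case case p of (n, d) \<Rightarrow> (n div d, d) of (m, r) \<Rightarrow> (m * r, r)) = p"
      if "p \<in> Sigma {1..} (\<lambda>n. {d. d dvd n})" for p :: "nat \<times> nat" using that by auto
    show "(case p of (n, d) \<Rightarrow> (n div d, d)) \<in> {1..} \<times> {1..}"
      if "p \<in> Sigma {1..} (\<lambda>n. {d. d dvd n})" for p :: "nat \<times> nat" using that 
      by (auto simp: Suc_le_eq elim!: dvdE)
  qed (auto simp: F_def mult.commute elim!: dvdE)
  moreover have "((\<lambda>d. (\<lambda>(n, d). of_nat d ^ j * q ^ n) (n, d)) has_sum 
           of_nat (divisor_sigma j n) * q ^ n) {d. d dvd n}" if "n \<in> {1..}" for n
    using that by (intro has_sum_finiteI) (auto simp: divisor_sigma_def sum_distrib_right)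
  ultimately have "((\<lambda>n. of_nat (divisor_sigma j n) * q ^ n) has_sum T) {1..}"
    by (rule has_sum_SigmaD)
  hence "((\<lambda>n. fps_nth (sigma_fps j) n * q ^ n) has_sum T) UNIV"
    by (rule has_sum_cong_neutral[THEN iffD1, rotated -1]) (auto simp: sigma_fps_def)
  hence 2: "(\<lambda>n. fps_nth (sigma_fps j) n * q ^ n) sums T"
    by (rule has_sum_imp_sums)
  hence 3: "eval_fps (sigma_fps j) q = T"
    unfolding eval_fps_def by (simp add: sums_iff)
  show "((\<lambda>m. eval_fps (power_fps j) (q ^ m)) has_sum eval_fps (sigma_fps j) q) {1..}"
    using 1 3 by simp
  show "(\<lambda>n. fps_nth (sigma_fps j) n * q ^ n) sums eval_fps (sigma_fps j) q"
    using 2 3 by simp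
qed

lemma fps_conv_radius_sigma_fps: "fps_conv_radius (sigma_fps j) \<ge> 1"
proof -
  have "conv_radius (fps_nth (sigma_fps j)) \<ge> ereal 1"
  proof (rule conv_radius_geI_ex)
    fix r :: real assume "0 < r" "ereal r < ereal 1"
    thus "\<exists>z. norm z = r \<and> summable (\<lambda>n. fps_nth (sigma_fps j) n * z ^ n)"
      using lambert_series(2)[of "of_real r" j] by (intro exI[of _ "of_real r"]) (auto simp: sums_iff)
  qed
  thus ?thesis by (simp add: fps_conv_radius_def one_ereal_def)
qed

lemma eisenstein_fps_altdef:
  "eisenstein_fps k = 1 - fps_const (complex_of_real (2 * real k / bernoulli k)) * sigma_fps (k - 1)"
  unfolding eisenstein_fps_def sigma_fps_def ..

lemma fps_conv_radius_eisenstein: "fps_conv_radius (eisenstein_fps k) \<ge> 1"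
proof -
  have "1 \<le> fps_conv_radius (fps_const (complex_of_real (2 * real k / bernoulli k)) * sigma_fps (k - 1))"
    using fps_conv_radius_mult[of "fps_const (complex_of_real (2 * real k / bernoulli k))" "sigma_fps (k - 1)"]
          fps_conv_radius_sigma_fps[of "k - 1"] by (auto simp: min_def split: if_splits)
  thus ?thesis unfolding eisenstein_fps_altdef
    using fps_conv_radius_diff[of 1 "fps_const (complex_of_real (2 * real k / bernoulli k)) * sigma_fps (k - 1)"]
    by (auto simp: min_def split: if_splits)
qed

lemma eval_eisenstein_fps:
  assumes "norm q < 1"
  shows "eval_fps (eisenstein_fps k) q = 1 - of_real (2 * real k / bernoulli k) * eval_fps (sigma_fps (k - 1)) q"
proof -
  have *: "ereal (norm q) < fps_conv_radius (sigma_fps (k - 1))"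
    using assms fps_conv_radius_sigma_fps by (rule norm_less_fps_conv_radius)
  moreover have "ereal (norm q) < fps_conv_radius (fps_const (complex_of_real (2 * real k / bernoulli k)) * sigma_fps (k - 1))"
    by (rule less_le_trans[OF _ fps_conv_radius_mult]) (use * in simp)
  ultimately show ?thesis unfolding eisenstein_fps_altdef
    by (subst eval_fps_diff) (auto simp: eval_fps_mult)
qed

text \<open>The row m = 0 of the half lattice contributes zeta(k). Each row m >= 1 is a Lipschitz
  sum in q^m, and the rows together form a Lambert series. Euler's formula turns the ratio of the
  two constants into -2k/B_k.\<close>

lemma lattice_sum_eisenstein:
  assumes z: "Im z > 0" and k: "even k" "k \<ge> 4"
  defines "\<zeta> \<equiv> Polygamma (k - 1) (1 :: complex) / fact (k - 1)"
  shows "lattice_sum k z = 2 * \<zeta> * eisenstein k z" and "\<zeta> \<noteq> 0"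
proof -
  define f where "f = lattice_term k z"
  define c where "c = (2 * of_real pi * \<i>) ^ k / fact (k - 1)"
  define q where "q = q_of z"
  have q: "norm q < 1" using z by (simp add: q_def norm_q_of_less_1)
  have sum: "f summable_on A" for A unfolding f_def using z k by (intro lattice_summable')
  have "Polygamma (k - 1) (1 :: complex) = of_real (Polygamma (k - 1) 1)"
    by (subst Polygamma_of_real [symmetric]) auto
  moreover have "Polygamma (k - 1) (1 :: real) > 0"
    using k by (intro Polygamma_real_odd_pos) (auto elim!: nonpos_Ints_cases)
  ultimately show \<zeta>: "\<zeta> \<noteq> 0" by (simp add: \<zeta>_def)
  have "infsum f half_lattice = infsum f ({0} \<times> {1..}) + infsum f ({1..} \<times> UNIV)"
    unfolding half_lattice_def by (intro infsum_Un_disjoint sum) auto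
  also have "infsum f ({0} \<times> {1..}) = \<zeta>"
  proof -
    have "infsum f (Pair 0 ` {1..}) = infsum (f \<circ> Pair 0) {1..}"
      by (rule infsum_reindex) (auto simp: inj_on_def)
    also have "f \<circ> Pair 0 = (\<lambda>n. 1 / of_int n ^ k)"
      by (auto simp: f_def lattice_term_def)
    also have "infsum (\<lambda>n::int. 1 / of_int n ^ k) {1..} = \<zeta>"
      unfolding \<zeta>_def using k by (intro infsumI has_sum_zeta) auto
    also have "Pair 0 ` {1..} = {0} \<times> {1..}" by auto
    finally show ?thesis .
  qed
  also have "infsum f ({1..} \<times> UNIV) = c * eval_fps (sigma_fps (k - 1)) q"
  proof -
    have "(f has_sum infsum f ({1..} \<times> UNIV)) ({1..} \<times> UNIV)"
      using sum by (rule has_sum_infsum)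
    moreover have "((\<lambda>n. f (m, n)) has_sum (c * eval_fps (power_fps (k - 1)) (q_of (of_int m * z)))) UNIV"
      if "m \<in> {1..}" for m
      using has_sum_shifted_inverse_powers[of "of_int m * z" k] that z k
      by (auto simp: f_def lattice_term_def c_def)
    ultimately have "((\<lambda>m. c * eval_fps (power_fps (k - 1)) (q_of (of_int m * z))) has_sum 
                        infsum f ({1..} \<times> UNIV)) {1..}"
      by (rule has_sum_SigmaD)
    hence "((\<lambda>m. c * eval_fps (power_fps (k - 1)) (q ^ m)) has_sum infsum f ({1..} \<times> UNIV)) {1..}"
      by (subst has_sum_reindex_bij_witness[of _ nat int]) (auto simp: q_def q_of_power)
    moreover have "((\<lambda>m. c * eval_fps (power_fps (k - 1)) (q ^ m)) has_sum 
                      (c * eval_fps (sigma_fps (k - 1)) q)) {1..}"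
      by (intro has_sum_cmult_right lambert_series q)
    ultimately show ?thesis by (rule has_sum_unique)
  qed
  finally have sum_half: "infsum f half_lattice = \<zeta> + c * eval_fps (sigma_fps (k - 1)) q" .
  have z': "\<zeta> = - (of_real (bernoulli k / fact k) * (2 * of_real pi * \<i>) ^ k / 2)"
    unfolding \<zeta>_def using k by (intro Polygamma_1_bernoulli) auto
  \<comment> \<open>Nonvanishing of B_k is read off from zeta(k) > 0, so the division by
    \<open>bernoulli k\<close> is a genuine one.\<close>
  have B: "bernoulli k \<noteq> 0" using \<zeta> unfolding z' by auto
  have fact: "(fact k :: complex) = of_nat k * fact (k - 1)"
    using k by (simp add: fact_reduce)
  have "c = - \<zeta> * of_real (2 * real k / bernoulli k)"
    unfolding z' c_def using B k by (simp add: fact field_simps)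
  hence "infsum f half_lattice = \<zeta> * eisenstein k z"
    unfolding sum_half eisenstein_def q_def[symmetric] eval_eisenstein_fps[OF q] by (simp add: algebra_simps)
  thus "lattice_sum k z = 2 * \<zeta> * eisenstein k z"
    using lattice_sum_half[OF z, of k] k by (simp add: f_def)
qed

section \<open>Bounding the remainder\<close>

text \<open>The half lattice without (0, 1) and (1, 0), whose terms are the main terms 1 and
  z^(-k).\<close>

definition lattice_rest :: "(int \<times> int) set" where
  "lattice_rest = {0} \<times> {2..} \<union> {1} \<times> (- {0}) \<union> {2..} \<times> UNIV"

definition eisenstein_rest :: "nat \<Rightarrow> complex \<Rightarrow> complex" where
  "eisenstein_rest k z = infsum (lattice_term k z) lattice_rest"

lemma lattice_sum_main_terms:
  assumes z: "Im z > 0" and k: "k \<ge> 4" "even k"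
  shows "lattice_sum k z = 2 * (1 + 1 / z ^ k + eisenstein_rest k z)"
proof -
  define f where "f = lattice_term k z"
  have sum: "f summable_on A" for A unfolding f_def using z k by (intro lattice_summable')
  have "half_lattice = insert (0, 1) (insert (1, 0) lattice_rest)"
    unfolding half_lattice_def lattice_rest_def by auto
  moreover have "(0, 1) \<notin> insert (1, 0) lattice_rest" "(1, 0) \<notin> lattice_rest"
    by (auto simp: lattice_rest_def)
  ultimately have "infsum f half_lattice = f (0, 1) + (f (1, 0) + infsum f lattice_rest)"
    using infsum_insert[OF sum, of "(0, 1)" "insert (1, 0) lattice_rest"] 
          infsum_insert[OF sum, of "(1, 0)" lattice_rest] by metis
  thus ?thesis
    unfolding lattice_sum_half[OF z k] f_def eisenstein_rest_def[symmetric] by (simp add: lattice_term_def)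
qed

lemma has_sum_inverse_squares_ge_2: "((\<lambda>n::int. 1 / (of_int n)\<^sup>2) has_sum (pi\<^sup>2 / 6 - 1)) {2..}"
proof -
  have "(\<lambda>n. 1 / (real (Suc n) + 1)\<^sup>2) sums (pi\<^sup>2 / 6 - 1)"
    using inverse_squares_sums by (subst sums_Suc_iff) (simp add: add.commute)
  hence "((\<lambda>n. 1 / (real (Suc n) + 1)\<^sup>2) has_sum (pi\<^sup>2 / 6 - 1)) UNIV"
    by (rule sums_nonneg_imp_has_sum) auto
  also have "?this \<longleftrightarrow> ?thesis"
    by (rule has_sum_reindex_bij_witness[of _ "\<lambda>n. nat (n - 2)" "\<lambda>n. int n + 2"]) (auto simp: add_ac)
  finally show ?thesis .
qed

lemma has_sum_inverse_squares_abs_ge_2: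
  "((\<lambda>n::int. 1 / (of_int n)\<^sup>2) has_sum (2 * (pi\<^sup>2 / 6 - 1))) {n. \<bar>n\<bar> \<ge> 2}"
proof -
  have "((\<lambda>n::int. 1 / (of_int n)\<^sup>2) has_sum (pi\<^sup>2 / 6 - 1)) {..-2} \<longleftrightarrow>
        ((\<lambda>n::int. 1 / (of_int n)\<^sup>2) has_sum (pi\<^sup>2 / 6 - 1)) {2..}"
    by (rule has_sum_reindex_bij_witness[of _ uminus uminus]) auto
  hence "((\<lambda>n::int. 1 / (of_int n)\<^sup>2) has_sum ((pi\<^sup>2 / 6 - 1) + (pi\<^sup>2 / 6 - 1))) ({2..} \<union> {..-2})"
    using has_sum_inverse_squares_ge_2 by (intro has_sum_Un_disjoint) auto
  also have "{2..} \<union> {..-2} = {n::int. \<bar>n\<bar> \<ge> 2}" by auto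
  finally show ?thesis by simp
qed

text \<open>The bound for \<open>norm (m z + n) powi (- 12)\<close> comes from \<open>norm (z + 1)\<^sup>2 \<ge> 1.91\<close> and, with \<open>\<bar>Re z\<bar> \<le> 1 / 2\<close>, from
  \<open>norm (z + n)\<^sup>2 \<ge> 3 / 4 n\<^sup>2\<close> for \<open>\<bar>n\<bar> \<ge> 2\<close> and \<open>norm (m z + n)\<^sup>2 \<ge> n\<^sup>2 / 4 + 0.69 m\<^sup>2\<close> for \<open>m \<ge> 2\<close>; high powers are
  then traded for \<open>1 / m\<^sup>2\<close> and \<open>1 / n\<^sup>2\<close>, whose sums are explicit.\<close>

definition rest_bound :: "real \<Rightarrow> int \<times> int \<Rightarrow> real" where
  "rest_bound c = (\<lambda>(m, n).
     if m = 0 then 1 / 1024 * (1 / (of_int n)\<^sup>2)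
     else if m = 1 then (if n = -1 then c else if n = 1 then 21 / 1000 else 6 / 1024 * (1 / (of_int n)\<^sup>2))
     else 442 / 100 * (if m = 2 then 1 / 256 else 1 / 729 * (1 / (of_int m)\<^sup>2)) *
          (if n = 0 then 1323 / 10000 else 3637 / 10000 * (1 / (of_int n)\<^sup>2)))"

text \<open>With pi^2/6 - 1 <= 0.645, the rows m = 0, m = 1 and m >= 2 contribute at most about
  0.001, c + 0.029 and 0.027. For m >= 2 the bound is a product of a function of m and a function of
  n, so its double sum is a product of two single sums.\<close>

lemma rest_bound_has_sum:
  obtains S where "(rest_bound c has_sum S) lattice_rest" "S \<le> c + 6 / 100"
proof -
  define s where "s = pi\<^sup>2 / 6 - 1"
  have "pi\<^sup>2 \<le> (31416/10000)\<^sup>2" using pi_approx by (intro power_mono) auto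
  hence s: "s \<le> 645 / 1000" by (simp add: s_def power2_eq_square)
  have s0: "s \<ge> 0" unfolding s_def 
    using power_mono[of 3 pi 2] pi_gt3 by simp
  note sums2 = has_sum_inverse_squares_ge_2[folded s_def] has_sum_inverse_squares_abs_ge_2[folded s_def]

  have 0: "(rest_bound c has_sum (1 / 1024 * s)) ({0} \<times> {2..})"
  proof -
    have "((\<lambda>n::int. 1 / 1024 * (1 / (of_int n)\<^sup>2)) has_sum (1 / 1024 * s)) {2..}"
      by (intro has_sum_cmult_right sums2)
    hence "((rest_bound c \<circ> Pair 0) has_sum (1 / 1024 * s)) {2..}"
      by (simp add: rest_bound_def o_def)
    hence "(rest_bound c has_sum (1 / 1024 * s)) (Pair 0 ` {2..})"
      by (subst has_sum_reindex) (auto simp: inj_on_def)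
    also have "Pair 0 ` {2..} = {0} \<times> {2..}" by auto
    finally show ?thesis .
  qed
  have 1: "(rest_bound c has_sum (6 / 1024 * (2 * s) + (c + 21 / 1000))) ({1} \<times> (- {0}))"
  proof -
    define g where "g = rest_bound c \<circ> Pair 1"
    have "((\<lambda>n::int. 6 / 1024 * (1 / (of_int n)\<^sup>2)) has_sum (6 / 1024 * (2 * s))) {n. \<bar>n\<bar> \<ge> 2}"
      by (intro has_sum_cmult_right sums2)
    also have "?this \<longleftrightarrow> (g has_sum (6 / 1024 * (2 * s))) {n. \<bar>n\<bar> \<ge> 2}"
      by (intro has_sum_cong) (auto simp: g_def rest_bound_def)
    finally have "(g has_sum (6 / 1024 * (2 * s))) {n. \<bar>n\<bar> \<ge> 2}" .
    moreover have "(g has_sum (c + 21 / 1000)) {-1, 1}"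
      by (intro has_sum_finiteI) (auto simp: g_def rest_bound_def)
    ultimately have "(g has_sum (6 / 1024 * (2 * s) + (c + 21 / 1000))) ({n. \<bar>n\<bar> \<ge> 2} \<union> {-1, 1})"
      by (intro has_sum_Un_disjoint) auto
    also have "{n. \<bar>n\<bar> \<ge> 2} \<union> {-1, 1} = - {0 :: int}" by auto
    finally have "(rest_bound c has_sum (6 / 1024 * (2 * s) + (c + 21 / 1000))) (Pair 1 ` (- {0}))"
      by (subst has_sum_reindex) (auto simp: inj_on_def g_def o_def)
    also have "Pair 1 ` (- {0}) = {1} \<times> (- {0})" by auto
    finally show ?thesis .
  qed
  define a where "a = (\<lambda>m::int. if m = 2 then 1 / 256 else 1 / 729 * (1 / (of_int m)\<^sup>2) :: real)"
  define b where "b = (\<lambda>n::int. if n = 0 then 1323 / 10000 else 3637 / 10000 * (1 / (of_int n)\<^sup>2) :: real)"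
  define sa where "sa = 1 / 256 + 1 / 729 * (s - 1 / 4)"
  define sb where "sb = 3637 / 10000 * (2 * s) + (1323 / 10000 + 2 * (3637 / 10000))"
  have a: "(a has_sum sa) {2..}"
  proof -
    have "((\<lambda>n::int. 1 / (of_int n)\<^sup>2) has_sum (s - 1 / 4)) ({2..} - {2})"
      using sums2(1) by (rule has_sum_Diff) (auto intro: has_sum_finiteI)
    also have "{2..} - {2::int} = {3..}" by auto
    finally have "((\<lambda>n::int. 1 / 729 * (1 / (of_int n)\<^sup>2)) has_sum (1 / 729 * (s - 1 / 4))) {3..}"
      by (intro has_sum_cmult_right)
    also have "?this \<longleftrightarrow> (a has_sum (1 / 729 * (s - 1 / 4))) {3..}"
      by (intro has_sum_cong) (auto simp: a_def)
    finally have "(a has_sum (1 / 256 + 1 / 729 * (s - 1 / 4))) ({2} \<union> {3..})"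
      by (intro has_sum_Un_disjoint) (auto intro!: has_sum_finiteI simp: a_def)
    also have "{2} \<union> {3..} = {2::int..}" by auto
    finally show ?thesis by (simp add: sa_def)
  qed
  have b: "(b has_sum sb) UNIV"
  proof -
    have "((\<lambda>n::int. 3637 / 10000 * (1 / (of_int n)\<^sup>2)) has_sum (3637 / 10000 * (2 * s))) {n. \<bar>n\<bar> \<ge> 2}"
      by (intro has_sum_cmult_right sums2)
    also have "?this \<longleftrightarrow> (b has_sum (3637 / 10000 * (2 * s))) {n. \<bar>n\<bar> \<ge> 2}"
      by (intro has_sum_cong) (auto simp: b_def)
    finally have "(b has_sum sb) ({n. \<bar>n\<bar> \<ge> 2} \<union> {-1, 0, 1})"
      unfolding sb_def by (intro has_sum_Un_disjoint) (auto intro!: has_sum_finiteI simp: b_def)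
    also have "{n. \<bar>n\<bar> \<ge> 2} \<union> {-1, 0, 1} = (UNIV :: int set)" by auto
    finally show ?thesis .
  qed
  have ab0: "a m \<ge> 0" "b n \<ge> 0" for m n by (auto simp: a_def b_def)
  have 2: "(rest_bound c has_sum (442 / 100 * sa * sb)) ({2..} \<times> UNIV)"
  proof (rule has_sum_SigmaI)
    have eq: "rest_bound c (m, n) = 442 / 100 * a m * b n" if "m \<in> {2..}" for m n
      using that by (auto simp: rest_bound_def a_def b_def)
    show "((\<lambda>n. rest_bound c (m, n)) has_sum (442 / 100 * a m * sb)) UNIV" if "m \<in> {2..}" for m
      unfolding eq[OF that] by (intro has_sum_cmult_right b)
    show "((\<lambda>m. 442 / 100 * a m * sb) has_sum (442 / 100 * sa * sb)) {2..}"
      by (intro has_sum_cmult_right has_sum_cmult_left a)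
    have "(\<lambda>(m, n). (442 / 100 * a m) * b n) summable_on {2..} \<times> UNIV"
      using a b ab0 by (intro summable_on_real_product summable_on_cmult_right) (auto simp: summable_on_def)
    also have "?this \<longleftrightarrow> rest_bound c summable_on {2..} \<times> UNIV"
      by (intro summable_on_cong) (auto simp: eq)
    finally show "rest_bound c summable_on {2..} \<times> UNIV" .
  qed
  have "(rest_bound c has_sum (1 / 1024 * s + (6 / 1024 * (2 * s) + (c + 21 / 1000)) + 442 / 100 * sa * sb)) lattice_rest"
    unfolding lattice_rest_def by (intro has_sum_Un_disjoint 0 1 2) auto
  moreover have "1 / 1024 * s + (6 / 1024 * (2 * s) + (c + 21 / 1000)) + 442 / 100 * sa * sb \<le> c + 6 / 100"
  proof -
    have "sa \<le> 1 / 256 + 1 / 729 * (645 / 1000 - 1 / 4)"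
      unfolding sa_def by (intro add_mono mult_left_mono diff_right_mono s) auto
    hence "sa \<le> 4449 / 1000000" by simp
    moreover have "sb \<le> 133 / 100" using s by (auto simp: sb_def)
    moreover have "sb \<ge> 0" using s0 by (auto simp: sb_def)
    ultimately have "sa * sb \<le> 4449 / 1000000 * (133 / 100)" by (intro mult_mono) auto
    hence "442 / 100 * sa * sb \<le> 442 / 100 * (4449 / 1000000 * (133 / 100))" by simp
    thus ?thesis using s by simp
  qed
  ultimately show ?thesis by (rule that)
qed

text \<open>One majorant serves twice: with B = 1 it bounds the remainder, and with B proportional
  to the distance of two parameters it bounds the increment.\<close>

lemma infsum_lattice_rest_le:
  fixes f :: "int \<times> int \<Rightarrow> complex"
  assumes f: "\<And>p. p \<in> lattice_rest \<Longrightarrow> norm (f p) \<le> B * rest_bound c p" and B: "B \<ge> 0"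
  shows "norm (infsum f lattice_rest) \<le> B * (c + 6 / 100)"
proof -
  obtain S where S: "(rest_bound c has_sum S) lattice_rest" "S \<le> c + 6 / 100"
    by (rule rest_bound_has_sum)
  have *: "((\<lambda>p. B * rest_bound c p) has_sum (B * S)) lattice_rest"
    using S(1) by (rule has_sum_cmult_right)
  have "(\<lambda>p. norm (f p)) summable_on lattice_rest"
    using * f by (intro Infinite_Sum.abs_summable_on_comparison_test'[of "\<lambda>p. B * rest_bound c p"]) 
      (auto simp: summable_on_def)
  hence "f summable_on lattice_rest" by (rule abs_summable_summable)
  hence "norm (infsum f lattice_rest) \<le> B * S"
    by (rule norm_infsum_le[OF has_sum_infsum * f])
  also have "\<dots> \<le> B * (c + 6 / 100)" using S(2) B by (rule mult_left_mono)
  finally show ?thesis .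
qed

text \<open>The estimates of the tail of the lattice sum hold in this region; \<open>c\<close> bounds the one term
  \<open>(z - 1) powi (- 12)\<close> that is not uniformly small.\<close>

definition tail_region :: "real \<Rightarrow> complex \<Rightarrow> bool" where
  "tail_region c z \<longleftrightarrow> 0 \<le> Re z \<and> Re z \<le> 1 / 2 \<and> Im z > 0 \<and> (Im z)\<^sup>2 \<ge> 78 / 100 \<and> 
     (norm z)\<^sup>2 \<ge> 91 / 100 \<and> norm (z - 1) \<ge> 1 \<and> 1 / norm (z - 1) ^ 12 \<le> c"

text \<open>In each case a lower bound L >= 1 for |mz + n|^2 is enough, because then |mz + n|^(-12)
  <= L^(-6). The point (1, -1) is the exception: there the hypothesis supplies the value
  \<open>c\<close>. The bound N >= 1 is what later permits any exponent k >= 12.\<close>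

lemma lattice_point_bound:
  assumes z: "tail_region c z" and p: "(m, n) \<in> lattice_rest"
  defines "N \<equiv> norm (of_int m * z + of_int n)"
  shows "N \<ge> 1" and "1 / N ^ 12 \<le> rest_bound c (m, n)"
proof -
  define x y where "x = Re z" and "y = Im z"
  have x: "0 \<le> x" "x \<le> 1 / 2" and y: "y > 0" "y\<^sup>2 \<ge> 78 / 100" and A: "x\<^sup>2 + y\<^sup>2 \<ge> 91 / 100"
    using z by (auto simp: tail_region_def x_def y_def cmod_power2)
  define Q where "Q = N\<^sup>2"
  have Q: "Q = (of_int m * x + of_int n)\<^sup>2 + (of_int m * y)\<^sup>2"
    by (simp add: Q_def N_def norm_lattice_point x_def y_def)
  have N12: "N ^ 12 = Q ^ 6" by (simp add: Q_def flip: power_mult)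
  have key: "N \<ge> 1 \<and> 1 / N ^ 12 \<le> rest_bound c (m, n)" 
    if "L \<le> Q" "1 \<le> L" "1 / L ^ 6 \<le> rest_bound c (m, n)" for L
  proof
    have "1\<^sup>2 \<le> N\<^sup>2" using that by (simp add: Q_def)
    thus "N \<ge> 1" by (rule power2_le_imp_le) (simp add: N_def)
    have "1 / Q ^ 6 \<le> 1 / L ^ 6" using that by (intro divide_left_mono power_mono) auto
    thus "1 / N ^ 12 \<le> rest_bound c (m, n)" using that N12 by simp
  qed
  consider "m = 0" "n \<ge> 2" | "m = 1" "n = -1" | "m = 1" "n = 1" | "m = 1" "\<bar>n\<bar> \<ge> 2" | "m \<ge> 2"
    using p by (auto simp: lattice_rest_def) linarith
  hence "N \<ge> 1 \<and> 1 / N ^ 12 \<le> rest_bound c (m, n)"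
  proof cases
    case 1
    define t where "t = real_of_int n"
    have t: "t \<ge> 2" using 1 by (simp add: t_def)
    show ?thesis
    proof (rule key[of "t\<^sup>2"])
      have "2 ^ 10 * t\<^sup>2 \<le> t ^ 10 * t\<^sup>2" using t by (intro mult_right_mono power_mono) auto
      hence "1024 * t\<^sup>2 \<le> (t\<^sup>2) ^ 6" by (simp flip: power_add power_mult)
      hence "1 / (t\<^sup>2) ^ 6 \<le> 1 / (1024 * t\<^sup>2)" using t by (intro divide_left_mono) auto
      thus "1 / (t\<^sup>2) ^ 6 \<le> rest_bound c (m, n)" using 1 by (simp add: rest_bound_def t_def)
      show "1 \<le> t\<^sup>2" using power_mono[of 1 t 2] t by simp
    qed (simp add: Q 1 t_def)
  next
    case 2
    thus ?thesis using z by (simp add: N_def rest_bound_def tail_region_def)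
  next
    case 3
    show ?thesis
    proof (rule key[of "191 / 100"])
      have "Q = (x\<^sup>2 + y\<^sup>2) + 2 * x + 1" using 3 by (simp add: Q power2_eq_square algebra_simps)
      thus "191 / 100 \<le> Q" using A x by simp
      show "1 / (191 / 100) ^ 6 \<le> rest_bound c (m, n)"
        using 3 by (simp add: rest_bound_def power_divide)
    qed auto
  next
    case 4
    define t where "t = \<bar>real_of_int n\<bar>"
    have t: "t \<ge> 2" using 4 by (simp add: t_def)
    have "(x + of_int n)\<^sup>2 \<ge> (t - 1 / 2)\<^sup>2"
    proof (cases "n \<ge> 0")
      case True
      thus ?thesis using t x by (intro power_mono) (auto simp: t_def)
    next
      case False
      hence "(t - 1 / 2)\<^sup>2 \<le> (- (x + of_int n))\<^sup>2" using t x by (intro power_mono) (auto simp: t_def)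
      thus ?thesis by (simp only: power2_minus)
    qed
    hence "Q \<ge> (t - 1 / 2)\<^sup>2 + 78 / 100" unfolding Q using y 4 by simp
    also have "(t - 1 / 2)\<^sup>2 + 78 / 100 = 3 / 4 * t\<^sup>2 + (t / 2 - 1)\<^sup>2 + 3 / 100"
      by (simp add: power2_eq_square field_simps)
    finally have Qt: "Q \<ge> 3 / 4 * t\<^sup>2" 
      using zero_le_power2[of "t / 2 - 1"] by linarith
    show ?thesis
    proof (rule key[OF Qt])
      show "1 \<le> 3 / 4 * t\<^sup>2" using power_mono[of 2 t 2] t by simp
      have "2 ^ 10 * t\<^sup>2 \<le> t ^ 10 * t\<^sup>2" using t by (intro mult_right_mono power_mono) auto
      hence "1024 * t\<^sup>2 \<le> (t\<^sup>2) ^ 6" by (simp flip: power_add power_mult)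
      hence "(3 / 4) ^ 6 * (1024 * t\<^sup>2) \<le> (3 / 4) ^ 6 * (t\<^sup>2) ^ 6" by (rule mult_left_mono) auto
      hence "(3 / 4) ^ 6 * (1024 * t\<^sup>2) \<le> (3 / 4 * t\<^sup>2) ^ 6" by (simp only: power_mult_distrib)
      \<comment> \<open>The inequality (3/4)^6 > 1/6 accounts for the constant 6/1024 in
        \<open>rest_bound\<close>.\<close>
      moreover have "1 / 6 * (1024 * t\<^sup>2) \<le> (3 / 4) ^ 6 * (1024 * t\<^sup>2)"
        by (intro mult_right_mono) (auto simp: power_divide)
      ultimately have "1 / 6 * (1024 * t\<^sup>2) \<le> (3 / 4 * t\<^sup>2) ^ 6" by linarith
      hence "1 / (3 / 4 * t\<^sup>2) ^ 6 \<le> 1 / (1 / 6 * (1024 * t\<^sup>2))" using t by (intro divide_left_mono) auto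
      thus "1 / (3 / 4 * t\<^sup>2) ^ 6 \<le> rest_bound c (m, n)" using 4 by (auto simp: rest_bound_def t_def)
    qed
  next
    case 5
    define s t where "s = real_of_int m" and "t = real_of_int n"
    have s: "s \<ge> 2" using 5 by (simp add: s_def)
    have s2: "s\<^sup>2 \<ge> 4" using power_mono[of 2 s 2] s by simp
    \<comment> \<open>Completing the square with a quarter of t^2 kept back. Since x <= 1/2, the
      loss is at most s^2/12, and 0.78 - 1/12 > 0.69.\<close>
    have "(s * x + t)\<^sup>2 = t\<^sup>2 / 4 - (s * x)\<^sup>2 / 3 + 3 / 4 * (t + 4 / 3 * (s * x))\<^sup>2"
      by (simp add: power2_eq_square field_simps)
    hence "(s * x + t)\<^sup>2 \<ge> t\<^sup>2 / 4 - (s * x)\<^sup>2 / 3"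
      using zero_le_power2[of "t + 4 / 3 * (s * x)"] by linarith
    moreover have "(s * x)\<^sup>2 \<le> s\<^sup>2 * (1 / 4)"
      unfolding power_mult_distrib using x power_mono[of x "1/2" 2] 
      by (intro mult_left_mono) (auto simp: power_divide)
    moreover have "(s * y)\<^sup>2 \<ge> s\<^sup>2 * (78 / 100)"
      unfolding power_mult_distrib using y by (intro mult_left_mono) auto
    moreover have "Q = (s * x + t)\<^sup>2 + (s * y)\<^sup>2" by (simp add: Q s_def t_def)
    ultimately have Qst: "Q \<ge> t\<^sup>2 / 4 + 69 / 100 * s\<^sup>2" using s2 by linarith
    have Q1: "Q \<ge> 69 / 100 * s\<^sup>2" using Qst zero_le_power2[of t] by linarith
    \<comment> \<open>For s >= 2 one has 0.69 s^2 >= 2.76 > 11/4.\<close>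
    have Q2: "Q \<ge> (t\<^sup>2 + 11) / 4" using Qst s2 by simp
    have Qpos: "Q > 0" using Q1 s2 by linarith
    \<comment> \<open>Of the six factors Q, four are spent on decay in m and two on decay in n. The
      constants 4.42 and 0.1323 are 0.69^(-4) and (4/11)^2 rounded up.\<close>
    have "(69 / 100 * s\<^sup>2) ^ 4 * ((t\<^sup>2 + 11) / 4)\<^sup>2 \<le> Q ^ 4 * Q\<^sup>2"
      using Q1 Q2 s2 Qpos by (intro mult_mono power_mono) (auto intro: add_nonneg_nonneg)
    hence "(69 / 100 * s\<^sup>2) ^ 4 * ((t\<^sup>2 + 11) / 4)\<^sup>2 \<le> Q ^ 6" by (simp flip: power_add)
    moreover have tp: "((t\<^sup>2 + 11) / 4)\<^sup>2 > 0" by (intro zero_less_power divide_pos_pos add_nonneg_pos) auto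
    ultimately have "1 / Q ^ 6 \<le> 1 / ((69 / 100 * s\<^sup>2) ^ 4 * ((t\<^sup>2 + 11) / 4)\<^sup>2)"
      using s2 Qpos by (intro divide_left_mono mult_pos_pos) auto
    also have "\<dots> = 1 / (69 / 100) ^ 4 * (1 / s ^ 8) * (1 / ((t\<^sup>2 + 11) / 4)\<^sup>2)"
    proof -
      have "(69 / 100 * s\<^sup>2) ^ 4 = (69 / 100) ^ 4 * s ^ 8"
        by (simp only: power_mult_distrib) (simp flip: power_mult)
      thus ?thesis by simp
    qed
    also have "\<dots> \<le> 442 / 100 * (if m = 2 then 1 / 256 else 1 / 729 * (1 / (of_int m)\<^sup>2)) *
                      (if n = 0 then 1323 / 10000 else 3637 / 10000 * (1 / (of_int n)\<^sup>2))"
    proof (intro mult_mono)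
      show "1 / s ^ 8 \<le> (if m = 2 then 1 / 256 else 1 / 729 * (1 / (of_int m)\<^sup>2))"
      proof (cases "m = 2")
        case False
        hence "s \<ge> 3" using 5 by (simp add: s_def)
        hence "3 ^ 6 * s\<^sup>2 \<le> s ^ 6 * s\<^sup>2" by (intro mult_right_mono power_mono) auto
        hence "729 * s\<^sup>2 \<le> s ^ 8" by (simp flip: power_add)
        hence "1 / s ^ 8 \<le> 1 / (729 * s\<^sup>2)" using s by (intro divide_left_mono) auto
        thus ?thesis using False by (simp add: s_def)
      qed (simp add: s_def)
      show "1 / ((t\<^sup>2 + 11) / 4)\<^sup>2 \<le> (if n = 0 then 1323 / 10000 else 3637 / 10000 * (1 / (of_int n)\<^sup>2))"
      proof (cases "n = 0")
        case False
        hence t0: "t\<^sup>2 > 0" by (simp add: t_def)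
        \<comment> \<open>The arithmetic-geometric mean inequality, giving 16/44 < 0.3637.\<close>
        have "(t\<^sup>2 + 11)\<^sup>2 = (t\<^sup>2 - 11)\<^sup>2 + 44 * t\<^sup>2" by (simp add: power2_eq_square algebra_simps)
        hence "44 / 16 * t\<^sup>2 \<le> ((t\<^sup>2 + 11) / 4)\<^sup>2"
          using zero_le_power2[of "t\<^sup>2 - 11"] by (simp add: power_divide)
        hence "1 / ((t\<^sup>2 + 11) / 4)\<^sup>2 \<le> 1 / (44 / 16 * t\<^sup>2)"
          using t0 tp by (intro divide_left_mono mult_pos_pos) auto
        also have "\<dots> = 16 / 44 * (1 / t\<^sup>2)" by simp
        also have "\<dots> \<le> 3637 / 10000 * (1 / t\<^sup>2)" by (intro mult_right_mono) auto
        finally show ?thesis using False by (simp add: t_def)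
      qed (simp add: t_def power_divide)
    qed (auto simp: power_divide)
    finally have "1 / N ^ 12 \<le> rest_bound c (m, n)"
      using 5 N12 by (simp add: rest_bound_def)
    moreover have "1\<^sup>2 \<le> N\<^sup>2" using Q1 s2 unfolding Q_def by simp
    hence "N \<ge> 1" by (rule power2_le_imp_le) (simp add: N_def)
    ultimately show ?thesis by blast
  qed
  thus "N \<ge> 1" "1 / N ^ 12 \<le> rest_bound c (m, n)" by auto
qed

lemma norm_lattice_term_le:
  assumes z: "tail_region c z" and p: "p \<in> lattice_rest" and k: "k \<ge> 12"
  shows "norm (lattice_term k z p) \<le> rest_bound c p"
proof -
  obtain m n where mn: "p = (m, n)" by force
  define N where "N = norm (of_int m * z + of_int n)"
  have N: "N \<ge> 1" "1 / N ^ 12 \<le> rest_bound c (m, n)"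
    using lattice_point_bound[OF z, of m n] p by (auto simp: mn N_def)
  have "1 / N ^ k \<le> 1 / N ^ 12" using N k by (intro divide_left_mono power_increasing) auto
  thus ?thesis using N by (simp add: mn lattice_term_def norm_divide norm_power N_def)
qed

lemma norm_eisenstein_rest_le:
  assumes "tail_region c z" "k \<ge> 12"
  shows "norm (eisenstein_rest k z) \<le> c + 6 / 100"
  using infsum_lattice_rest_le[of "lattice_term k z" 1 c] norm_lattice_term_le[OF assms(1) _ assms(2)]
  by (simp add: eisenstein_rest_def)

section \<open>Parametrisation of the unit arc\<close>

text \<open>The parametrisation of a neighbourhood of the unit arc in which \<open>z powi (-k)\<close> becomes \<open>exp (\<i> t)\<close>
  and real \<open>t\<close> corresponds to \<open>norm z = 1\<close>.\<close>

definition arc_point :: "nat \<Rightarrow> complex \<Rightarrow> complex" where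
  "arc_point k t = \<i> * exp (- \<i> * t / of_nat k)"

lemma norm_arc_point: "norm (arc_point k t) = exp (Im t / real k)"
  and Re_arc_point: "Re (arc_point k t) = exp (Im t / real k) * sin (Re t / real k)"
  and Im_arc_point: "Im (arc_point k t) = exp (Im t / real k) * cos (Re t / real k)"
  by (simp_all add: arc_point_def norm_mult exp_eq_polar Re_exp Im_exp)

lemma arc_point_power:
  assumes "k mod 4 = 0" "k > 0"
  shows "1 / arc_point k t ^ k = exp (\<i> * t)"
proof -
  obtain j where j: "k = 4 * j" using assms(1) by auto
  have "\<i> ^ k = 1" unfolding j power_mult by simp
  hence "arc_point k t ^ k = exp (- (\<i> * t))"
    using assms(2) by (simp add: arc_point_def power_mult_distrib flip: exp_of_nat_mult)
  thus ?thesis by (simp add: exp_minus divide_inverse)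
qed

lemma arc_point_minus_cnj: "arc_point k (- cnj t) = - cnj (arc_point k t)"
  by (simp add: arc_point_def exp_cnj)

lemma arc_point_minus: "arc_point k (- t) = - 1 / arc_point k t"
  by (simp add: arc_point_def exp_minus divide_inverse)

text \<open>For z in the upper half plane, -iz lies in the right half plane, so the principal
  logarithm has imaginary part below pi/2 in modulus.\<close>

lemma arc_point_surj:
  assumes "Im z > 0" "k > 0"
  obtains t where "arc_point k t = z" "\<bar>Re t\<bar> < real k * (pi / 2)" "Im t = real k * ln (norm z)"
proof -
  have z: "z \<noteq> 0" using assms by auto
  define t where "t = \<i> * of_nat k * Ln (- \<i> * z)"
  have "arc_point k t = z"
    using z assms by (simp add: arc_point_def t_def)
  moreover have "\<bar>Im (Ln (- \<i> * z))\<bar> < pi / 2"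
    using assms z by (subst Re_Ln_pos_lt) auto
  hence "\<bar>Re t\<bar> < real k * (pi / 2)"
    using assms by (simp add: t_def abs_mult)
  moreover have "Im t = real k * ln (norm z)"
    using z by (simp add: t_def norm_mult)
  ultimately show ?thesis by (rule that)
qed

definition arc_sum :: "nat \<Rightarrow> complex \<Rightarrow> complex" where
  "arc_sum k t = lattice_sum k (arc_point k t) / 2"

definition arc_rest :: "nat \<Rightarrow> complex \<Rightarrow> complex" where
  "arc_rest k t = eisenstein_rest k (arc_point k t)"

lemma arc_sum_eq:
  assumes "k mod 4 = 0" "k \<ge> 12" "Im (arc_point k t) > 0"
  shows "arc_sum k t = 1 + exp (\<i> * t) + arc_rest k t"
proof -
  have "even k" using assms(1) by presburger
  thus ?thesis using assms lattice_sum_main_terms[of "arc_point k t" k]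
    by (simp add: arc_sum_def arc_rest_def arc_point_power)
qed

text \<open>Combining \<open>z \<mapsto> - 1 / z\<close> with \<open>z \<mapsto> - cnj z\<close>.\<close>

lemma arc_sum_cnj_eq_0:
  assumes k: "even k" and t: "Im (arc_point k t) > 0" "arc_sum k t = 0"
  shows "arc_sum k (cnj t) = 0"
proof -
  have "arc_point k (cnj t) = - cnj (- 1 / arc_point k t)"
    using arc_point_minus_cnj[of k "- t"] arc_point_minus[of k t] by simp
  thus ?thesis
    using t lattice_sum_cnj[OF k, of "- 1 / arc_point k t"] lattice_sum_inversion[OF t(1), of k]
    by (simp add: arc_sum_def)
qed

lemma cos_ge_one_minus: "1 - x\<^sup>2 / 2 \<le> cos x" for x :: real
proof -
  have "\<bar>sin (x / 2)\<bar>\<^sup>2 \<le> \<bar>x / 2\<bar>\<^sup>2"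
    by (intro power_mono abs_sin_x_le_abs_x) auto
  thus ?thesis using cos_double_sin[of "x / 2"] by (simp add: power_divide)
qed

text \<open>Here \<open>a\<close> bounds the angle Re t / k and \<open>h\<close> bounds |Im t|;
  since k >= 12, the modulus is at least 1 - h/12. The remaining inequalities are numerical checks
  left to each application. The second claim is 1/cos <= 11/10 for angles up to 2/5.\<close>

lemma tail_region_arc_point:
  assumes k: "k \<ge> 12" and t: "0 \<le> Re t" "Re t \<le> a * real k" "\<bar>Im t\<bar> \<le> h"
    and h: "0 \<le> h" "h \<le> 1 / 2" and a: "0 \<le> a" "a \<le> 2 / 5"
    and c: "1 - h / 12 \<ge> a" "(1 - h / 12)\<^sup>2 * (1 - a\<^sup>2 / 2)\<^sup>2 \<ge> 78 / 100" 
      "(1 - h / 12)\<^sup>2 \<ge> 2 * (1 - h / 12) * a" "1 / ((1 - h / 12)\<^sup>2 + 1 - 2 * (1 - h / 12) * a) ^ 6 \<le> c"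
  shows "tail_region c (arc_point k t)" "norm (arc_point k t) \<le> 11 / 10 * Im (arc_point k t)"
proof -
  define r where "r = exp (Im t / real k)"
  define \<phi> where "\<phi> = Re t / real k"
  define x y where "x = r * sin \<phi>" and "y = r * cos \<phi>"
  define r0 where "r0 = 1 - h / 12"
  have z: "Re (arc_point k t) = x" "Im (arc_point k t) = y" "norm (arc_point k t) = r"
    by (simp_all add: norm_arc_point Re_arc_point Im_arc_point x_def y_def r_def \<phi>_def)
  have \<phi>: "0 \<le> \<phi>" "\<phi> \<le> a" using t k by (auto simp: \<phi>_def field_simps)
  have Im: "\<bar>Im t / real k\<bar> \<le> h / 12"
  proof -
    have "\<bar>Im t\<bar> / real k \<le> h / 12" using t k h by (intro frac_le) auto
    thus ?thesis by simp
  qed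
  have r: "r \<ge> r0"
    using exp_ge_add_one_self[of "Im t / real k"] Im unfolding r_def r0_def by linarith
  have r0: "r0 \<ge> 23 / 24" using h by (simp add: r0_def)
  have "r0 \<le> exp (- (Im t / real k))"
    using exp_ge_add_one_self[of "- (Im t / real k)"] Im unfolding r0_def by linarith
  hence "r0 * r \<le> 1" unfolding r_def by (simp add: exp_minus field_simps)
  moreover have "23 / 24 * r \<le> r0 * r" using r r0 by (intro mult_right_mono) auto
  ultimately have r_le: "r \<le> 24 / 23" by linarith
  have s: "0 \<le> sin \<phi>" "sin \<phi> \<le> \<phi>"
    using \<phi> a pi_gt3 by (auto intro!: sin_ge_zero sin_x_le_x)
  have "a\<^sup>2 \<le> (2/5)\<^sup>2" using a by (intro power_mono) auto
  hence a2: "a\<^sup>2 / 2 \<le> 2 / 25" by (simp add: power2_eq_square)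
  have "1 - \<phi>\<^sup>2 / 2 \<le> cos \<phi>" by (rule cos_ge_one_minus)
  moreover have "\<phi>\<^sup>2 \<le> a\<^sup>2" using \<phi> by (intro power_mono) auto
  ultimately have c1: "cos \<phi> \<ge> 1 - a\<^sup>2 / 2" by linarith
  hence c2: "cos \<phi> \<ge> 23 / 25" using a2 by linarith
  have rpos: "r > 0" using r r0 by linarith
  show "norm (arc_point k t) \<le> 11 / 10 * Im (arc_point k t)"
  proof -
    have "r * 1 \<le> r * (11 / 10 * cos \<phi>)" using rpos c2 by (intro mult_left_mono) auto
    thus ?thesis unfolding z y_def by simp
  qed
  have "x \<le> 24 / 23 * (2 / 5)"
    unfolding x_def using r_le s \<phi> a rpos by (intro mult_mono) auto
  moreover have "0 \<le> x" using s rpos by (simp add: x_def)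
  moreover have "y > 0" unfolding y_def using rpos c2 by (intro mult_pos_pos) auto
  moreover have "y\<^sup>2 \<ge> 78 / 100"
  proof -
    have "78 / 100 \<le> (r0 * (1 - a\<^sup>2 / 2))\<^sup>2" using c by (simp add: r0_def power_mult_distrib)
    also have "\<dots> \<le> y\<^sup>2" unfolding y_def using r r0 c1 a2 by (intro power_mono mult_mono mult_nonneg_nonneg) auto
    finally show ?thesis .
  qed
  moreover have "r\<^sup>2 \<ge> 91 / 100"
    using power_mono[of "23/24" r 2] r r0 by (simp add: power_divide)
  moreover have n1: "(norm (arc_point k t - 1))\<^sup>2 \<ge> r0\<^sup>2 + 1 - 2 * r0 * a"
  proof -
    have "(norm (arc_point k t - 1))\<^sup>2 = (x - 1)\<^sup>2 + y\<^sup>2" by (simp add: cmod_power2 z)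
    also have "\<dots> = x\<^sup>2 + y\<^sup>2 + 1 - 2 * x" by (simp add: power2_eq_square algebra_simps)
    also have "x\<^sup>2 + y\<^sup>2 = r\<^sup>2 * ((sin \<phi>)\<^sup>2 + (cos \<phi>)\<^sup>2)"
      unfolding x_def y_def by (simp only: power_mult_distrib distrib_left)
    also have "(sin \<phi>)\<^sup>2 + (cos \<phi>)\<^sup>2 = 1" by (rule sin_cos_squared_add)
    finally have "(norm (arc_point k t - 1))\<^sup>2 = r\<^sup>2 + 1 - 2 * x" by simp
    moreover have "x \<le> r * a" unfolding x_def using rpos s \<phi> by (intro mult_left_mono) auto
    \<comment> \<open>The function r^2 - 2ra increases for r >= a, so its minimum is at the lower
      bound \<open>r0\<close>.\<close>
    moreover have "0 \<le> (r - r0) * (r + r0 - 2 * a)"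
      using r c(1) by (intro mult_nonneg_nonneg) (auto simp: r0_def)
    hence "r0\<^sup>2 - 2 * r0 * a \<le> r\<^sup>2 - 2 * (r * a)" by (simp add: power2_eq_square algebra_simps)
    ultimately show ?thesis by linarith
  qed
  moreover have "norm (arc_point k t - 1) \<ge> 1"
    using n1 c(3) by (intro power2_le_imp_le[of 1]) (auto simp: r0_def)
  moreover have "1 / norm (arc_point k t - 1) ^ 12 \<le> c"
  proof -
    have pos: "r0\<^sup>2 + 1 - 2 * r0 * a > 0" using c(3) by (simp add: r0_def)
    have "(r0\<^sup>2 + 1 - 2 * r0 * a) ^ 6 \<le> ((norm (arc_point k t - 1))\<^sup>2) ^ 6"
      using n1 pos by (intro power_mono) auto
    hence "(r0\<^sup>2 + 1 - 2 * r0 * a) ^ 6 \<le> norm (arc_point k t - 1) ^ 12"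
      by (simp flip: power_mult)
    hence "1 / norm (arc_point k t - 1) ^ 12 \<le> 1 / (r0\<^sup>2 + 1 - 2 * r0 * a) ^ 6"
      using pos by (intro divide_left_mono mult_pos_pos) (auto intro: less_le_trans[of _ "(r0\<^sup>2 + 1 - 2 * r0 * a) ^ 6"])
    also have "\<dots> \<le> c" using c(4) by (simp add: r0_def)
    finally show ?thesis .
  qed
  ultimately show "tail_region c (arc_point k t)"
    unfolding tail_region_def z by auto
qed

text \<open>The t-derivative of (mz + n)^(-k) is i m z/(mz + n) times the term itself: the factor k
  from the power cancels the 1/k in the parametrisation, so the constant does not grow with k.
  Moreover |mz| <= L |m| Im z = L |Im(mz + n)| <= L |mz + n|.\<close>

lemma arc_rest_lipschitz:
  assumes k: "k \<ge> 12" and K: "convex K" "t1 \<in> K" "t2 \<in> K" and L: "L \<ge> 0"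
    and reg: "\<And>t. t \<in> K \<Longrightarrow> tail_region c (arc_point k t)"
      "\<And>t. t \<in> K \<Longrightarrow> norm (arc_point k t) \<le> L * Im (arc_point k t)"
  shows "norm (arc_rest k t1 - arc_rest k t2) \<le> L * (c + 6 / 100) * norm (t1 - t2)"
proof -
  define f where "f = (\<lambda>p t. lattice_term k (arc_point k t) p)"
  have lip: "norm (f p t1 - f p t2) \<le> (L * norm (t1 - t2)) * rest_bound c p" if p: "p \<in> lattice_rest" for p
  proof -
    obtain m n where mn: "p = (m, n)" by force
    have "norm (f p t1 - f p t2) \<le> (L * rest_bound c p) * norm (t1 - t2)"
    proof (rule field_differentiable_bound[OF K(1) _ _ K(2,3)])
      fix t assume t: "t \<in> K"
      define w where "w = arc_point k t"
      define v where "v = of_int m * w + of_int n"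
      have w: "(arc_point k has_field_derivative (- \<i> / of_nat k * w)) (at t within K)"
      proof -
        have "(arc_point k has_field_derivative (\<i> * (exp (- \<i> * t / of_nat k) * (- \<i> / of_nat k)))) 
                (at t within K)"
          unfolding arc_point_def[abs_def] using k by (auto intro!: derivative_eq_intros)
        thus ?thesis by (simp add: w_def arc_point_def mult_ac)
      qed
      have v: "norm v \<ge> 1" "norm (lattice_term k w p) \<le> rest_bound c p"
        using lattice_point_bound(1)[OF reg(1)[OF t], of m n] norm_lattice_term_le[OF reg(1)[OF t] p k] p
        by (auto simp: mn v_def w_def)
      hence v0: "v \<noteq> 0" by auto
      have "((\<lambda>t. 1 / (of_int m * arc_point k t + of_int n) ^ k) has_field_derivative
              (\<i> * of_int m * w / v * (1 / v ^ k))) (at t within K)"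
      proof -
        have vk: "v ^ k = v * v ^ (k - 1)" using k by (cases k) auto
        have "((\<lambda>t. 1 / (of_int m * arc_point k t + of_int n) ^ k) has_field_derivative
           - (of_nat k * v ^ (k - 1) * (of_int m * (- \<i> / of_nat k * w))) / (v ^ k * v ^ k)) (at t within K)"
          using v0 unfolding v_def w_def by (auto intro!: derivative_eq_intros w[unfolded w_def])
        also have "- (of_nat k * v ^ (k - 1) * (of_int m * (- \<i> / of_nat k * w))) / (v ^ k * v ^ k) =
                   \<i> * of_int m * w / v * (1 / v ^ k)"
          using v0 k unfolding vk by (simp add: field_simps)
        finally show ?thesis .
      qed
      thus "(f p has_field_derivative (\<i> * of_int m * w / v * lattice_term k w p)) (at t within K)"
        by (simp add: f_def mn lattice_term_def v_def)
      have "norm (\<i> * of_int m * w / v) \<le> L"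
      proof -
        have "norm (\<i> * of_int m * w) = \<bar>of_int m\<bar> * norm w" by (simp add: norm_mult)
        also have "\<dots> \<le> \<bar>of_int m\<bar> * (L * Im w)" using reg(2)[OF t] by (intro mult_left_mono) (auto simp: w_def)
        also have "\<dots> = L * (\<bar>of_int m\<bar> * Im w)" by simp
        also have "\<dots> \<le> L * norm v"
        proof (rule mult_left_mono[OF _ L])
          have "\<bar>of_int m\<bar> * Im w = \<bar>Im v\<bar>"
            using reg(1)[OF t] by (simp add: v_def abs_mult w_def tail_region_def)
          thus "\<bar>of_int m\<bar> * Im w \<le> norm v" using abs_Im_le_cmod[of v] by simp
        qed
        finally show ?thesis using v(1) L by (simp add: norm_divide divide_le_eq)
      qed
      thus "norm (\<i> * of_int m * w / v * lattice_term k w p) \<le> L * rest_bound c p"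
        unfolding norm_mult[of _ "lattice_term k w p"] using v(2) L by (intro mult_mono) auto
    qed
    thus ?thesis by (simp add: mult_ac)
  qed
  have "Im (arc_point k t) > 0" if "t \<in> K" for t using reg(1)[OF that] by (auto simp: tail_region_def)
  hence sum: "(\<lambda>p. f p t) summable_on lattice_rest" if "t \<in> K" for t
    using that k unfolding f_def by (intro lattice_summable') auto
  have "arc_rest k t1 - arc_rest k t2 = infsum (\<lambda>p. f p t1 + - f p t2) lattice_rest"
    using sum[OF K(2)] sum[OF K(3)]
    by (subst infsum_add) (auto simp: infsum_uminus summable_on_uminus arc_rest_def eisenstein_rest_def f_def)
  also have "norm \<dots> \<le> (L * norm (t1 - t2)) * (c + 6 / 100)"
    using lip L by (intro infsum_lattice_rest_le) auto
  finally show ?thesis by (simp add: mult_ac)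
qed

section \<open>The zero near the top of the arc\<close>

lemma norm_derivative_le:
  fixes f :: "complex \<Rightarrow> complex"
  assumes f: "(f has_field_derivative D) (at x)" and e: "e > 0"
    and lip: "\<And>y. y \<in> ball x e \<Longrightarrow> norm (f y - f x) \<le> B * norm (y - x)"
  shows "norm D \<le> B"
proof (rule tendsto_upperbound)
  show "((\<lambda>y. norm ((f y - f x) / (y - x))) \<longlongrightarrow> norm D) (at x)"
    using f by (intro tendsto_norm) (simp add: has_field_derivative_iff)
  have "eventually (\<lambda>y. y \<in> ball x e - {x}) (at x)"
    using e by (intro eventually_at_in_open) auto
  thus "eventually (\<lambda>y. norm ((f y - f x) / (y - x)) \<le> B) (at x)"
    by eventually_elim (use lip in \<open>auto simp: norm_divide divide_le_eq\<close>)
qed auto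

lemma norm_Ln_1_plus_diff_le:
  assumes u: "norm u \<le> C" and v: "norm v \<le> C" and C: "C < 1"
  shows "norm (Ln (1 + u) - Ln (1 + v)) \<le> 1 / (1 - C) * norm (u - v)"
proof (rule field_differentiable_bound[OF convex_cball[of 0 C]])
  fix z :: complex assume z: "z \<in> cball 0 C"
  have "Re (1 + z) > 0" using z C abs_Re_le_cmod[of z] by auto
  hence nz: "1 + z \<notin> \<real>\<^sub>\<le>\<^sub>0" by (auto simp: complex_nonpos_Reals_iff)
  thus "((\<lambda>z. Ln (1 + z)) has_field_derivative 1 / (1 + z)) (at z within cball 0 C)"
    by (auto intro!: derivative_eq_intros simp: inverse_eq_divide)
  have "1 - C \<le> norm (1 + z)" using z norm_triangle_ineq2[of 1 "- z"] by simp
  thus "norm (1 / (1 + z)) \<le> 1 / (1 - C)" using C by (simp add: norm_divide frac_le)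
qed (use u v in auto)

lemma norm_Ln_1_plus_le:
  assumes "norm u \<le> C" "C < 1"
  shows "norm (Ln (1 + u)) \<le> C / (1 - C)"
proof -
  have C: "0 \<le> C" using assms norm_ge_zero[of u] by linarith
  have "norm (Ln (1 + u) - Ln (1 + 0)) \<le> 1 / (1 - C) * norm (u - 0)"
    using assms C by (intro norm_Ln_1_plus_diff_le) auto
  also have "\<dots> \<le> 1 / (1 - C) * C" using assms by (intro mult_left_mono) auto
  finally show ?thesis by simp
qed

context
  fixes k :: nat
  assumes k12: "k \<ge> 12" and k4: "k mod 4 = 0"
begin

lemma even_k: "even k" using k4 by presburger

abbreviation near_disc :: "complex set" where
  "near_disc \<equiv> cball (of_real pi) (1 / 2)"

lemma near_disc_Re_Im:
  assumes "t \<in> near_disc"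
  shows "\<bar>Re t - pi\<bar> \<le> 1 / 2" "\<bar>Im t\<bar> \<le> 1 / 2"
  using assms abs_Re_le_cmod[of "t - of_real pi"] abs_Im_le_cmod[of "t - of_real pi"]
  by (auto simp: dist_norm norm_minus_commute)

lemma near_disc_region:
  assumes "t \<in> near_disc"
  shows "tail_region (18 / 100) (arc_point k t)" "norm (arc_point k t) \<le> 11 / 10 * Im (arc_point k t)"
proof -
  \<comment> \<open>This exceeds (3.15 + 1/2)/12, the largest angle Re t / k on the disc. With h =
    1/2 it yields the bound 0.18 for |z - 1|^(-12), hence 0.24 for the remainder and 1.1 times 0.24
    for its Lipschitz constant.\<close>
  define a :: real where "a = 3042 / 10000"
  have "pi \<le> 315 / 100" using pi_approx by simp
  hence "Re t \<le> 365 / 100" "0 \<le> Re t" using near_disc_Re_Im[OF assms] pi_gt3 by linarith+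
  moreover have "365 / 100 \<le> a * 12" by (simp add: a_def)
  moreover have "a * 12 \<le> a * real k" using k12 by (intro mult_left_mono) (auto simp: a_def)
  ultimately have "Re t \<le> a * real k" "0 \<le> Re t" by linarith+
  hence t: "0 \<le> Re t" "Re t \<le> a * real k" "\<bar>Im t\<bar> \<le> 1 / 2"
    using near_disc_Re_Im[OF assms] by blast+
  note * = tail_region_arc_point[OF k12 t, of "18 / 100"]
  show "tail_region (18 / 100) (arc_point k t)"
    by (rule *(1)) (simp_all add: a_def power2_eq_square power_divide)
  show "norm (arc_point k t) \<le> 11 / 10 * Im (arc_point k t)"
    by (rule *(2)) (simp_all add: a_def power2_eq_square power_divide)
qed

lemma near_disc_Im_pos: "t \<in> near_disc \<Longrightarrow> Im (arc_point k t) > 0"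
  using near_disc_region(1)[of t] by (auto simp: tail_region_def)

lemma near_disc_arc_rest: "t \<in> near_disc \<Longrightarrow> norm (arc_rest k t) \<le> 24 / 100"
  using norm_eisenstein_rest_le[OF near_disc_region(1) k12, of t] by (simp add: arc_rest_def)

lemma near_disc_lipschitz:
  assumes "t1 \<in> near_disc" "t2 \<in> near_disc"
  shows "norm (arc_rest k t1 - arc_rest k t2) \<le> 264 / 1000 * norm (t1 - t2)"
  using arc_rest_lipschitz[OF k12 convex_cball assms, of "11 / 10" "18 / 100"] near_disc_region by auto

text \<open>The window of half-width pi around pi is where the principal logarithm inverts exp(i(t -
  pi)); the equation for a zero thus becomes a fixed point equation.\<close>

lemma near_zero_iff:
  assumes t: "Im (arc_point k t) > 0" "\<bar>Re t - pi\<bar> < pi" and R: "norm (arc_rest k t) < 1"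
  shows "arc_sum k t = 0 \<longleftrightarrow> t = of_real pi - \<i> * Ln (1 + arc_rest k t)"
proof
  have nz: "1 + arc_rest k t \<noteq> 0"
    using R by (metis add_eq_0_iff norm_minus_cancel norm_one less_irrefl)
  have e: "exp (\<i> * t) = - exp (\<i> * (t - of_real pi))"
    by (simp add: right_diff_distrib exp_diff)
  have F: "arc_sum k t = 1 + exp (\<i> * t) + arc_rest k t"
    using k4 k12 t(1) by (rule arc_sum_eq)
  show "t = of_real pi - \<i> * Ln (1 + arc_rest k t)" if "arc_sum k t = 0"
  proof -
    have "exp (\<i> * (t - of_real pi)) = 1 + arc_rest k t"
      using that unfolding F e by (simp add: algebra_simps)
    hence "Ln (1 + arc_rest k t) = Ln (exp (\<i> * (t - of_real pi)))" by simp
    also have "\<dots> = \<i> * (t - of_real pi)" using t(2) by (intro Ln_exp) auto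
    finally have "\<i> * Ln (1 + arc_rest k t) = \<i> * (\<i> * (t - of_real pi))" by simp
    thus ?thesis by simp
  qed
  show "arc_sum k t = 0" if "t = of_real pi - \<i> * Ln (1 + arc_rest k t)"
  proof -
    have "\<i> * (t - of_real pi) = Ln (1 + arc_rest k t)" by (subst that) (simp add: algebra_simps)
    hence "exp (\<i> * t) = - (1 + arc_rest k t)" unfolding e using nz by simp
    thus ?thesis unfolding F by simp
  qed
qed

lemma near_zero_iff': "t \<in> near_disc \<Longrightarrow> arc_sum k t = 0 \<longleftrightarrow> t = of_real pi - \<i> * Ln (1 + arc_rest k t)"
  using near_disc_Re_Im[of t] near_disc_arc_rest[of t] near_disc_Im_pos[of t] pi_gt3
  by (intro near_zero_iff) auto

text \<open>Banach's fixed point theorem. The disc is preserved because 0.24/0.76 < 1/2, and the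
  contraction constant is 0.264/0.76.\<close>

lemma ex1_near_zero: "\<exists>!t. t \<in> near_disc \<and> arc_sum k t = 0"
proof -
  define T where "T = (\<lambda>t. of_real pi - \<i> * Ln (1 + arc_rest k t))"
  have "\<exists>!t\<in>near_disc. T t = t"
  proof (rule Banach_fix)
    show "complete near_disc" "near_disc \<noteq> {}"
      by (auto simp: complete_eq_closed)
    show "T ` near_disc \<subseteq> near_disc"
    proof safe
      fix t assume "t \<in> near_disc"
      hence "norm (Ln (1 + arc_rest k t)) \<le> (24 / 100) / (1 - 24 / 100)"
        by (intro norm_Ln_1_plus_le near_disc_arc_rest) auto
      thus "T t \<in> near_disc" by (simp add: T_def dist_norm norm_mult)
    qed
    show "dist (T s) (T t) \<le> 264 / 760 * dist s t" if st: "s \<in> near_disc" "t \<in> near_disc" for s t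
    proof -
      have "dist (T s) (T t) = norm (- \<i> * (Ln (1 + arc_rest k s) - Ln (1 + arc_rest k t)))"
        by (simp add: dist_norm T_def algebra_simps)
      also have "\<dots> = norm (Ln (1 + arc_rest k s) - Ln (1 + arc_rest k t))"
        by (simp add: norm_mult)
      also have "\<dots> \<le> 1 / (1 - 24 / 100) * norm (arc_rest k s - arc_rest k t)"
        using st by (intro norm_Ln_1_plus_diff_le near_disc_arc_rest) auto
      also have "\<dots> \<le> 1 / (1 - 24 / 100) * (264 / 1000 * norm (s - t))"
        using st by (intro mult_left_mono near_disc_lipschitz) auto
      finally show "dist (T s) (T t) \<le> 264 / 760 * dist s t" by (simp add: dist_norm)
    qed
  qed auto
  moreover have "t \<in> near_disc \<and> arc_sum k t = 0 \<longleftrightarrow> t \<in> near_disc \<and> T t = t" for t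
    using near_zero_iff'[of t] by (auto simp: T_def)
  ultimately show ?thesis by (simp only:)
qed

text \<open>Taking the real part loses nothing, since the unique zero turns out to be real.\<close>

definition top_angle :: real where
  "top_angle = Re (THE t. t \<in> near_disc \<and> arc_sum k t = 0)"

text \<open>The conjugate of the zero is a zero in the same disc, so uniqueness makes it real. The
  constant 0.316 is 0.24/0.76 rounded up.\<close>

lemma top_angle:
  shows "of_real top_angle \<in> near_disc" "arc_sum k (of_real top_angle) = 0"
    and "\<And>t. t \<in> near_disc \<Longrightarrow> arc_sum k t = 0 \<Longrightarrow> t = of_real top_angle"
    and "\<bar>top_angle - pi\<bar> \<le> 316 / 1000"
proof -
  define t where "t = (THE t. t \<in> near_disc \<and> arc_sum k t = 0)"
  have t: "t \<in> near_disc" "arc_sum k t = 0"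
    using theI'[OF ex1_near_zero] by (auto simp: t_def)
  have uniq: "t' = t" if "t' \<in> near_disc" "arc_sum k t' = 0" for t'
    using ex1_near_zero t that by blast
  have "cnj t \<in> near_disc"
    using t(1) complex_mod_cnj[of "of_real pi - t"] by (simp add: dist_norm)
  moreover have "arc_sum k (cnj t) = 0"
    using even_k near_disc_Im_pos[OF t(1)] t(2) by (rule arc_sum_cnj_eq_0)
  ultimately have "cnj t = t" by (rule uniq)
  hence "t = of_real (Re t)" by (simp add: complex_eq_iff)
  hence eq: "t = of_real top_angle" unfolding top_angle_def t_def[symmetric] .
  show "of_real top_angle \<in> near_disc" "arc_sum k (of_real top_angle) = 0" using t eq by auto
  show "t' = of_real top_angle" if "t' \<in> near_disc" "arc_sum k t' = 0" for t'
    using uniq[OF that] eq by simp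
  have "norm (Ln (1 + arc_rest k t)) \<le> (24 / 100) / (1 - 24 / 100)"
    using t by (intro norm_Ln_1_plus_le near_disc_arc_rest) auto
  moreover have "of_real (top_angle - pi) = - \<i> * Ln (1 + arc_rest k t)"
    using near_zero_iff'[OF t(1)] t(2) eq by (simp add: algebra_simps)
  hence "\<bar>top_angle - pi\<bar> = norm (Ln (1 + arc_rest k t))"
    by (metis norm_of_real norm_mult norm_minus_cancel norm_ii mult_1)
  ultimately show "\<bar>top_angle - pi\<bar> \<le> 316 / 1000" by simp
qed

text \<open>At a real parameter the main term has derivative of modulus 1, and the remainder's
  derivative has modulus at most 0.264.\<close>

lemma top_angle_simple:
  assumes "(arc_sum k has_field_derivative D) (at (of_real top_angle))"
  shows "D \<noteq> 0"
proof
  assume D: "D = 0"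
  define t0 where "t0 = complex_of_real top_angle"
  \<comment> \<open>The radius 1/10 fits because 0.316 + 0.1 < 1/2.\<close>
  have ball: "y \<in> near_disc" if "y \<in> ball t0 (1 / 10)" for y
  proof -
    have "dist (of_real pi) t0 \<le> 316 / 1000"
      using top_angle(4) by (simp add: t0_def dist_norm abs_minus_commute flip: of_real_diff)
    thus ?thesis using that dist_triangle[of "of_real pi" y t0] by simp
  qed
  have "((\<lambda>t. arc_sum k t - 1 - exp (\<i> * t)) has_field_derivative (D - \<i> * exp (\<i> * t0))) (at t0)"
    using assms unfolding t0_def[symmetric] by (auto intro!: derivative_eq_intros)
  hence "norm (D - \<i> * exp (\<i> * t0)) \<le> 264 / 1000"
  proof (rule norm_derivative_le[of _ _ _ "1 / 10"])
    fix y assume y: "y \<in> ball t0 (1 / 10)"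
    have "arc_sum k t - 1 - exp (\<i> * t) = arc_rest k t" if "t \<in> near_disc" for t
      using arc_sum_eq[OF k4 k12 near_disc_Im_pos[OF that]] by simp
    thus "norm (arc_sum k y - 1 - exp (\<i> * y) - (arc_sum k t0 - 1 - exp (\<i> * t0))) \<le> 264 / 1000 * norm (y - t0)"
      using near_disc_lipschitz[of y t0] ball[OF y] ball[of t0] by simp
  qed auto
  moreover have "norm (D - \<i> * exp (\<i> * t0)) = 1"
    by (simp add: D norm_mult t0_def)
  ultimately show False by simp
qed

text \<open>\<open>arc_sum\<close> takes conjugate values at \<open>t\<close> and \<open>cnj t\<close> up to a factor, and on a vertical segment
  the main term \<open>exp (\<i> t)\<close> varies faster than the remainder.\<close>

lemma arc_zero_real:
  assumes t: "arc_sum k t = 0" "0 \<le> Re t" "Re t \<le> 4 / 10 * real k" "\<bar>Im t\<bar> \<le> 4 / 10"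
  shows "Im t = 0"
proof (rule ccontr)
  assume Im: "Im t \<noteq> 0"
  \<comment> \<open>A convex set containing both \<open>t\<close> and its conjugate, as the
    Lipschitz estimate requires. On it |z - 1|^(-12) <= 0.41.\<close>
  define K where "K = {t. 0 \<le> Re t} \<inter> {t. Re t \<le> 4 / 10 * real k} \<inter> {t. - (4 / 10) \<le> Im t} \<inter> {t. Im t \<le> 4 / 10}"
  have "convex K" unfolding K_def 
    by (intro convex_Int convex_halfspace_Re_le convex_halfspace_Re_ge 
              convex_halfspace_Im_le convex_halfspace_Im_ge)
  with t have K: "t \<in> K" "cnj t \<in> K" "convex K" by (auto simp: K_def)
  have reg: "tail_region (41 / 100) (arc_point k s)" 
            "norm (arc_point k s) \<le> 11 / 10 * Im (arc_point k s)" if "s \<in> K" for s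
  proof -
    have s: "0 \<le> Re s" "Re s \<le> 4 / 10 * real k" "\<bar>Im s\<bar> \<le> 4 / 10" using that by (auto simp: K_def)
    note * = tail_region_arc_point[OF k12 s, of "41 / 100"]
    show "tail_region (41 / 100) (arc_point k s)"
      by (rule *(1)) (simp_all add: power2_eq_square power_divide)
    show "norm (arc_point k s) \<le> 11 / 10 * Im (arc_point k s)"
      by (rule *(2)) (simp_all add: power2_eq_square power_divide)
  qed
  have pos: "Im (arc_point k s) > 0" if "s \<in> K" for s using reg(1)[OF that] by (auto simp: tail_region_def)
  have 0: "1 + exp (\<i> * t) + arc_rest k t = 0"
    using t arc_sum_eq[OF k4 k12 pos[OF K(1)]] by simp
  have 1: "1 + exp (\<i> * cnj t) + arc_rest k (cnj t) = 0"
    using arc_sum_cnj_eq_0[OF even_k pos[OF K(1)] t(1)] arc_sum_eq[OF k4 k12 pos[OF K(2)]] by simp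
  define b where "b = \<bar>Im t\<bar>"
  have b: "0 < b" "b \<le> 4 / 10" using Im t by (auto simp: b_def)
  have "exp (\<i> * t) - exp (\<i> * cnj t) = - (arc_rest k t - arc_rest k (cnj t))"
  proof -
    have "a - b = - (r - s)" if "1 + a + r = 0" "1 + b + s = 0" for a b r s :: complex
      using that by (simp add: add_eq_0_iff algebra_simps)
    thus ?thesis using 0 1 by blast
  qed
  hence "norm (exp (\<i> * t) - exp (\<i> * cnj t)) = norm (arc_rest k t - arc_rest k (cnj t))"
    by (metis norm_minus_cancel)
  also have "\<dots> \<le> 11 / 10 * (41 / 100 + 6 / 100) * norm (t - cnj t)"
    using k12 K(3,1,2) by (rule arc_rest_lipschitz) (use reg in auto)
  also have "t - cnj t = of_real (2 * Im t) * \<i>" by (simp add: complex_eq_iff)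
  also have "norm \<dots> = 2 * b" by (simp add: norm_mult b_def)
  finally have upper: "norm (exp (\<i> * t) - exp (\<i> * cnj t)) \<le> 1034 / 1000 * b" by simp
  have "exp (\<i> * t) = exp (\<i> * of_real (Re t)) * of_real (exp (- Im t))"
    by (subst exp_of_real[symmetric], subst exp_add[symmetric]) (simp add: complex_eq_iff Re_exp Im_exp)
  moreover have "exp (\<i> * cnj t) = exp (\<i> * of_real (Re t)) * of_real (exp (Im t))"
    by (subst exp_of_real[symmetric], subst exp_add[symmetric]) (simp add: complex_eq_iff Re_exp Im_exp)
  ultimately have "exp (\<i> * t) - exp (\<i> * cnj t) = 
      exp (\<i> * of_real (Re t)) * of_real (exp (- Im t) - exp (Im t))"
    by (simp add: algebra_simps)
  hence "norm (exp (\<i> * t) - exp (\<i> * cnj t)) = \<bar>exp (- Im t) - exp (Im t)\<bar>"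
    by (simp add: norm_mult flip: of_real_diff)
  also have "\<dots> = exp b - exp (- b)" by (auto simp: b_def abs_if)
  finally have "exp b - exp (- b) \<le> 1034 / 1000 * b" using upper by simp
  moreover have "exp b \<ge> 1 + b" by (rule exp_ge_add_one_self)
  \<comment> \<open>Altogether exp(b) - exp(-b) >= b + b/(1 + b) >= 3b/2, which exceeds the upper
    bound 1.034 b; that constant is twice 1.1 times 0.47.\<close>
  moreover have "exp (- b) \<le> 1 - b / (1 + b)"
  proof -
    have "exp (- b) = 1 / exp b" by (simp add: exp_minus inverse_eq_divide)
    also have "\<dots> \<le> 1 / (1 + b)" using b exp_ge_add_one_self[of b] by (intro divide_left_mono mult_pos_pos) auto
    also have "\<dots> = 1 - b / (1 + b)" using b by (simp add: field_simps)
    finally show ?thesis .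
  qed
  moreover have "b / (1 + b) \<ge> b / 2" using b by (intro divide_left_mono mult_pos_pos) auto
  ultimately show False using b by linarith
qed

end

section \<open>Zeros of maximal height\<close>

lemma q_of_minus_cnj: "q_of (- cnj z) = cnj (q_of z)"
  by (simp add: q_of_def exp_cnj)

context
  fixes k :: nat
  assumes k12: "k \<ge> 12" and k4: "k mod 4 = 0"
begin

definition top_zero :: complex where
  "top_zero = arc_point k (of_real (top_angle k))"

lemma eisenstein_eq_0_iff: "Im z > 0 \<Longrightarrow> eisenstein k z = 0 \<longleftrightarrow> lattice_sum k z = 0"
  using lattice_sum_eisenstein[of z k] even_k[OF k12 k4] k12 by simp

text \<open>The angle is at most (3.1416 + 0.316)/12, since k >= 12. The resulting height 0.958 is
  the starting point of the numerical exclusions in the strip.\<close>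

lemma top_zero:
  shows "norm top_zero = 1" "Im top_zero \<ge> 958 / 1000" "0 < Re top_zero" "Re top_zero < 1 / 2"
    and "lattice_sum k top_zero = 0" "Im top_zero = cos (top_angle k / real k)"
    and "0 < top_angle k" "top_angle k \<le> 346 / 100"
proof -
  have pi: "3 < pi" "pi \<le> 31416 / 10000" using pi_gt3 pi_approx by auto
  have \<theta>: "2 < top_angle k" "top_angle k \<le> 34576 / 10000"
    using top_angle(4)[OF k12 k4] pi by linarith+
  thus "0 < top_angle k" "top_angle k \<le> 346 / 100" by auto
  define \<phi> where "\<phi> = top_angle k / real k"
  have \<phi>: "0 < \<phi>" using \<theta> k12 by (simp add: \<phi>_def)
  have "\<phi> \<le> (34576 / 10000) / 12" unfolding \<phi>_def using \<theta> k12 by (intro frac_le) auto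
  hence \<phi>2: "\<phi> \<le> 2882 / 10000" by simp
  show "norm top_zero = 1" by (simp add: top_zero_def norm_arc_point)
  show "Im top_zero = cos (top_angle k / real k)" by (simp add: top_zero_def Im_arc_point)
  hence "Im top_zero = cos \<phi>" by (simp add: \<phi>_def)
  moreover have "\<phi>\<^sup>2 \<le> (2882 / 10000)\<^sup>2" using \<phi> \<phi>2 by (intro power_mono) auto
  hence "\<phi>\<^sup>2 / 2 \<le> 42 / 1000" by (simp add: power2_eq_square)
  ultimately show "Im top_zero \<ge> 958 / 1000" using cos_ge_one_minus[of \<phi>] by linarith
  have Re: "Re top_zero = sin \<phi>" by (simp add: top_zero_def Re_arc_point \<phi>_def)
  show "0 < Re top_zero" unfolding Re using \<phi> \<phi>2 pi by (intro sin_gt_zero) auto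
  show "Re top_zero < 1 / 2" unfolding Re using sin_x_le_x[of \<phi>] \<phi> \<phi>2 by simp
  show "lattice_sum k top_zero = 0"
    using top_angle(2)[OF k12 k4] by (simp add: arc_sum_def top_zero_def)
qed

text \<open>Far to the right both |w|^(-k) and the remainder are too small for their sum to reach 1.
  The remaining points have a small angle; there a zero must lie on the unit circle, and its
  parameter is either near pi, where uniqueness applies, or so large that the point is lower than
  \<open>top_zero\<close>.\<close>

lemma zero_in_right_strip:
  assumes w: "lattice_sum k w = 0" "norm w \<ge> 1" "0 \<le> Re w" "Re w \<le> 1 / 2" "Im w \<ge> Im top_zero"
  shows "w = top_zero"
proof -
  define x y where "x = Re w" and "y = Im w"
  have x: "0 \<le> x" "x \<le> 1 / 2" using w by (auto simp: x_def)
  have y: "y \<ge> 958 / 1000" using w top_zero(2) by (simp add: y_def)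
  have y2: "y\<^sup>2 \<ge> 9177 / 10000" using power_mono[OF y, of 2] by (simp add: power_divide)
  have Im: "Im w > 0" using y by (simp add: y_def)
  have w0: "w \<noteq> 0" using w by auto
  define A where "A = (norm w)\<^sup>2"
  have A: "A = x\<^sup>2 + y\<^sup>2" by (simp add: A_def cmod_power2 x_def y_def)
  define D where "D = (norm (w - 1))\<^sup>2"
  have D: "D = (1 - x)\<^sup>2 + y\<^sup>2" by (simp add: D_def cmod_power2 x_def y_def power2_commute)
  have A1: "A \<ge> 1" using power_mono[OF w(2), of 2] by (simp add: A_def)
  have sum: "1 + 1 / w ^ k + eisenstein_rest k w = 0"
  proof -
    have "2 * (1 + 1 / w ^ k + eisenstein_rest k w) = 0"
      using w(1) lattice_sum_main_terms[OF Im, of k] k12 even_k[OF k12 k4] by (simp only:)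
    thus ?thesis by (simp only: mult_eq_0_iff) simp
  qed
  have main: "1 \<le> norm (1 / w ^ k) + norm (eisenstein_rest k w)"
  proof -
    have "1 = norm (1 / w ^ k + eisenstein_rest k w)"
      using sum by (metis add.assoc add_eq_0_iff norm_minus_cancel norm_one)
    also have "\<dots> \<le> norm (1 / w ^ k) + norm (eisenstein_rest k w)" by (rule norm_triangle_ineq)
    finally show ?thesis .
  qed
  have rest: "norm (eisenstein_rest k w) \<le> c + 6 / 100"
    if b: "x \<le> b" "b \<le> 1 / 2" "1 / ((1 - b)\<^sup>2 + 9177 / 10000) ^ 6 \<le> c" for b c
  proof (rule norm_eisenstein_rest_le[OF _ k12])
    have "(1 - b)\<^sup>2 \<le> (1 - x)\<^sup>2" using b x by (intro power_mono) auto
    hence Db: "D \<ge> (1 - b)\<^sup>2 + 9177 / 10000" using y2 by (simp add: D)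
    moreover have "(1 / 2)\<^sup>2 \<le> (1 - b)\<^sup>2" using b by (intro power_mono) auto
    ultimately have D1: "D \<ge> 1" by (simp add: power_divide)
    have pos: "(1 - b)\<^sup>2 + 9177 / 10000 > 0" by (rule add_nonneg_pos) auto
    have "norm (w - 1) ^ 12 = D ^ 6" by (simp add: D_def flip: power_mult)
    moreover have "1 / D ^ 6 \<le> 1 / ((1 - b)\<^sup>2 + 9177 / 10000) ^ 6"
      using Db pos D1 by (intro divide_left_mono power_mono mult_pos_pos zero_less_power) auto
    moreover have "norm (w - 1) \<ge> 1"
      using D1 by (intro power2_le_imp_le[of 1]) (auto simp: D_def)
    ultimately show "tail_region c w"
      using x y y2 A1 b(3) Im unfolding tail_region_def A_def x_def y_def by auto
  qed
  \<comment> \<open>The term w^(-k) is bounded using the left end of the interval and (w - 1)^(-k)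
    using the right end; the limit 0.94 leaves room for the other 0.06 of the remainder.\<close>
  have not_between: False
    if "a \<le> x" "x \<le> b" "0 \<le> a" "b \<le> 1 / 2" 
      "1 / (a\<^sup>2 + 9177 / 10000) ^ 6 + 1 / ((1 - b)\<^sup>2 + 9177 / 10000) ^ 6 < 94 / 100" for a b
  proof -
    have "a\<^sup>2 \<le> x\<^sup>2" using that by (intro power_mono) auto
    hence Aa: "a\<^sup>2 + 9177 / 10000 \<le> A" using y2 by (simp add: A)
    have pos: "a\<^sup>2 + 9177 / 10000 > 0" by (rule add_nonneg_pos) auto
    have "norm (1 / w ^ k) = 1 / norm w ^ k" by (simp add: norm_divide norm_power)
    also have "\<dots> \<le> 1 / norm w ^ 12" using w(2) k12 by (intro divide_left_mono power_increasing mult_pos_pos zero_less_power) auto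
    also have "norm w ^ 12 = A ^ 6" by (simp add: A_def flip: power_mult)
    also have "1 / A ^ 6 \<le> 1 / (a\<^sup>2 + 9177 / 10000) ^ 6"
      using Aa pos A1 by (intro divide_left_mono power_mono mult_pos_pos zero_less_power) auto
    finally show False using main rest[OF that(2,4) order_refl] that(5) by linarith
  qed
  \<comment> \<open>Because the two bounds use opposite ends, a single interval would be too coarse,
    so three short ones are used.\<close>
  have x387: "x \<le> 387 / 1000"
  proof (rule ccontr)
    assume *: "\<not> x \<le> 387 / 1000"
    have "\<not> (387 / 1000 \<le> x \<and> x \<le> 41 / 100)"
      using not_between[of "387 / 1000" "41 / 100"] by (auto simp: power2_eq_square power_divide)
    moreover have "\<not> (41 / 100 \<le> x \<and> x \<le> 44 / 100)"
      using not_between[of "41 / 100" "44 / 100"] by (auto simp: power2_eq_square power_divide)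
    moreover have "\<not> (44 / 100 \<le> x \<and> x \<le> 1 / 2)"
      using not_between[of "44 / 100" "1 / 2"] by (auto simp: power2_eq_square power_divide)
    ultimately show False using * x by linarith
  qed
  have "norm (eisenstein_rest k w) \<le> 214 / 1000 + 6 / 100"
    by (rule rest[OF x387]) (auto simp: power2_eq_square power_divide)
  hence R: "norm (eisenstein_rest k w) \<le> 274 / 1000" by simp
  obtain t where t: "arc_point k t = w" "\<bar>Re t\<bar> < real k * (pi / 2)" "Im t = real k * ln (norm w)"
    by (rule arc_point_surj[OF Im, of k]) (use k12 in auto)
  have t_R: "arc_rest k t = eisenstein_rest k w" by (simp add: arc_rest_def t)
  have t_zero: "arc_sum k t = 0" using w(1) by (simp add: arc_sum_def t)
  have exp_t: "1 / w ^ k = exp (\<i> * t)" using arc_point_power[OF k4, of t] k12 by (simp add: t)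
  have Im_t: "Im t \<ge> 0" using w(2) by (simp add: t)
  \<comment> \<open>Vanishing needs exp(-Im t) >= 1 - 0.274 = 0.726, whereas 1/1.4 < 0.715.\<close>
  have Im_t': "Im t \<le> 4 / 10"
  proof (rule ccontr)
    assume "\<not> Im t \<le> 4 / 10"
    hence "14 / 10 \<le> exp (Im t)" using exp_ge_add_one_self[of "Im t"] by linarith
    hence "1 / exp (Im t) \<le> 1 / (14 / 10)" by (intro divide_left_mono) auto
    moreover have "norm (1 / w ^ k) = 1 / exp (Im t)"
      unfolding exp_t by (simp add: exp_minus inverse_eq_divide)
    ultimately show False using main R by simp
  qed
  define \<phi> where "\<phi> = Re t / real k"
  have kpos: "real k > 0" using k12 by simp
  have \<phi>: "\<bar>\<phi>\<bar> < pi / 2" using t(2) kpos by (simp add: \<phi>_def divide_less_eq mult.commute)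
  have x_sin: "x = exp (Im t / real k) * sin \<phi>"
    using Re_arc_point[of k t] by (simp add: t x_def \<phi>_def)
  have e1: "exp (Im t / real k) \<ge> 1" using Im_t by simp
  have \<phi>0: "\<phi> \<ge> 0"
  proof (rule ccontr)
    assume "\<not> \<phi> \<ge> 0"
    hence "sin (- \<phi>) > 0" using \<phi> by (intro sin_gt_zero) auto
    hence "exp (Im t / real k) * sin \<phi> < 0" by (intro mult_pos_neg) auto
    thus False using x x_sin by simp
  qed
  \<comment> \<open>The cubic Taylor error gives sin(0.4) > 0.389, already beyond the bound 0.387 on
    the real part.\<close>
  have \<phi>4: "\<phi> \<le> 4 / 10"
  proof (rule ccontr)
    assume *: "\<not> \<phi> \<le> 4 / 10"
    have "sin (2 / 5) \<le> sin \<phi>" using * \<phi> by (intro sin_monotone_2pi_le) auto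
    moreover have "\<bar>sin (2 / 5) - 2 / 5\<bar> \<le> (4 / 375 :: real)"
      using Maclaurin_sin_bound[of "2 / 5" 3] 
      by (simp add: numeral_3_eq_3 sin_coeff_def fact_numeral) 
    hence "sin (2 / 5 :: real) \<ge> 389 / 1000" by linarith
    moreover have "1 * sin \<phi> \<le> x" unfolding x_sin using e1 \<phi>0 \<phi> 
      by (intro mult_right_mono sin_ge_zero) auto
    ultimately show False using x387 by simp
  qed
  have "Im t = 0"
    using t_zero \<phi>0 \<phi>4 kpos Im_t Im_t' 
    by (intro arc_zero_real[OF k12 k4]) (auto simp: \<phi>_def field_simps)
  hence t_real: "t = of_real (Re t)" by (simp add: complex_eq_iff)
  define \<tau> where "\<tau> = Re t"
  have \<tau>: "t = of_real \<tau>" using t_real by (simp add: \<tau>_def)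
  have \<tau>0: "\<tau> \<ge> 0" using \<phi>0 kpos by (simp add: \<tau>_def \<phi>_def field_simps)
  have Im_cos: "Im w = cos (\<tau> / real k)"
    using Im_arc_point[of k t] unfolding t(1) by (simp add: \<tau>)
  show ?thesis
  \<comment> \<open>On [0, 5 pi/2) the cosine is negative only between pi/2 and 3 pi/2, and there
    the fixed point equation applies. From 5 pi/2 on, the angle exceeds that of
    \<open>top_zero\<close>.\<close>
  proof (cases "\<tau> < 5 / 2 * pi")
    case True
    have "exp (\<i> * t) = - 1 - eisenstein_rest k w" using sum unfolding exp_t by (simp add: algebra_simps eq_neg_iff_add_eq_0)
    hence "Re (exp (\<i> * t)) = - 1 - Re (eisenstein_rest k w)" by simp
    hence cos: "cos \<tau> < 0" 
      using R abs_Re_le_cmod[of "eisenstein_rest k w"] by (simp add: \<tau> Re_exp)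
    have "\<tau> > pi / 2" using cos cos_ge_zero[of \<tau>] \<tau>0 pi_gt3 by linarith
    moreover have "\<tau> < 3 / 2 * pi"
      using cos cos_ge_zero[of "\<tau> - 2 * pi"] True cos_minus[of "\<tau>"] pi_gt3 by (force simp: cos_diff)
    ultimately have "\<bar>Re t - pi\<bar> < pi" using pi_gt3 by (simp add: \<tau> abs_less_iff)
    moreover have "Im (arc_point k t) > 0" "norm (arc_rest k t) < 1"
      using Im R by (simp_all only: t(1) t_R)
    ultimately have "t = of_real pi - \<i> * Ln (1 + arc_rest k t)"
      using near_zero_iff[OF k12 k4, of t] t_zero by blast
    hence "dist (of_real pi) t = norm (Ln (1 + arc_rest k t))"
      unfolding dist_norm by (metis diff_diff_eq2 add_diff_cancel_left' norm_mult norm_ii mult_1 diff_add_cancel)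
    also have "\<dots> \<le> (274 / 1000) / (1 - 274 / 1000)"
      unfolding t_R using R by (intro norm_Ln_1_plus_le) auto
    finally have "t \<in> cball (of_real pi) (1 / 2)" by simp
    hence "t = of_real (top_angle k)" using t_zero by (rule top_angle(3)[OF k12 k4])
    thus ?thesis by (simp add: top_zero_def flip: t(1))
  next
    case False
    have "top_angle k / real k < \<tau> / real k"
      using False top_zero(8) pi_gt3 kpos by (intro divide_strict_right_mono) auto
    hence "cos (\<tau> / real k) < cos (top_angle k / real k)"
    proof (intro cos_monotone_0_pi)
      show "\<tau> / real k \<le> pi" using \<phi> pi_gt3 unfolding \<tau>_def \<phi>_def[symmetric] by linarith
    qed (use top_zero(7) kpos in auto)
    thus ?thesis using w(5) Im_cos top_zero(6) by simp
  qed
qed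

lemma zero_outside_unit_disc:
  assumes w: "lattice_sum k w = 0" "norm w \<ge> 1" "\<bar>Re w\<bar> \<le> 1 / 2" "Im w \<ge> Im top_zero"
  shows "w = top_zero \<or> w = - cnj top_zero"
proof (cases "Re w \<ge> 0")
  case True
  thus ?thesis using zero_in_right_strip[of w] w by simp
next
  case False
  have "- cnj w = top_zero"
    using False w lattice_sum_cnj[OF even_k[OF k12 k4], of w] by (intro zero_in_right_strip) auto
  thus ?thesis by (metis complex_cnj_cnj complex_cnj_minus minus_minus)
qed

text \<open>Inside the unit circle the height forces |Re w| <= 0.4. Inversion then keeps the point
  in the strip and does not lower it, so its image would be one of the two known zeros, which is
  impossible because the image lies strictly outside the unit circle.\<close>

lemma zero_in_strip:
  assumes w: "lattice_sum k w = 0" "\<bar>Re w\<bar> \<le> 1 / 2" "Im w \<ge> Im top_zero"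
  shows "w = top_zero \<or> w = - cnj top_zero"
proof (cases "norm w \<ge> 1")
  case True
  thus ?thesis using w by (intro zero_outside_unit_disc) auto
next
  case False
  have y: "Im w \<ge> 958 / 1000" using w top_zero(2) by simp
  have y2: "(Im w)\<^sup>2 \<ge> 9177 / 10000" using power_mono[OF y, of 2] by (simp add: power_divide)
  have w0: "w \<noteq> 0" using y by auto
  define A where "A = (Re w)\<^sup>2 + (Im w)\<^sup>2"
  have A: "A = (norm w)\<^sup>2" by (simp add: A_def cmod_power2)
  have "(norm w)\<^sup>2 < 1" using False by (simp add: power_less_one_iff abs_square_less_1)
  hence A1: "A < 1" by (simp add: A)
  have A2: "9177 / 10000 \<le> A" using y2 zero_le_power2[of "Re w"] unfolding A_def by linarith
  note A1 = A1 A2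
  define w' where "w' = - 1 / w"
  have Re: "Re w' = - Re w / A" and Im: "Im w' = Im w / A"
    by (simp_all add: w'_def A_def Re_divide Im_divide)
  have n: "norm w' > 1" using False w0 by (simp add: w'_def norm_divide)
  have "lattice_sum k w' = 0" using lattice_sum_inversion[of w k] y w(1) by (simp add: w'_def)
  moreover have "\<bar>Re w'\<bar> \<le> 1 / 2"
  proof -
    have "(Re w)\<^sup>2 \<le> (4 / 10)\<^sup>2" using A1 y2 by (simp add: A_def power2_eq_square)
    hence "\<bar>Re w\<bar> \<le> 4 / 10" by (simp add: abs_le_square_iff[symmetric])
    hence "\<bar>Re w\<bar> \<le> 1 / 2 * A" using A1 by linarith
    thus ?thesis using A1 by (simp add: Re abs_divide divide_le_eq)
  qed
  moreover have "Im w' \<ge> Im top_zero"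
  proof -
    have "Im w / 1 \<le> Im w / A" using A1 y by (intro divide_left_mono) auto
    thus ?thesis using w(3) by (simp add: Im)
  qed
  ultimately have "w' = top_zero \<or> w' = - cnj top_zero"
    using n by (intro zero_outside_unit_disc) auto
  hence "norm w' = 1" using top_zero(1) by auto
  thus ?thesis using n by simp
qed

text \<open>Since \<open>top_zero\<close> lies in the domain, a maximiser is at least as high. Both
  alternatives are carried along: they give conjugate values of q and the same pair of
  poles.\<close>

lemma arg_max_zero:
  assumes "is_arg_max Im (\<lambda>w. w \<in> fundamental_domain \<and> eisenstein k w = 0) z"
  shows "z = top_zero \<or> z = - cnj top_zero"
proof -
  have z: "z \<in> fundamental_domain" "eisenstein k z = 0"
    and max: "\<And>w. w \<in> fundamental_domain \<Longrightarrow> eisenstein k w = 0 \<Longrightarrow> \<not> Im w > Im z"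
    using assms unfolding is_arg_max_def by auto
  have "top_zero \<in> fundamental_domain"
    using top_zero(1-4) by (simp add: fundamental_domain_def upper_half_plane_def)
  moreover have "eisenstein k top_zero = 0"
    using top_zero(2,5) by (subst eisenstein_eq_0_iff) auto
  ultimately have "Im z \<ge> Im top_zero" using max by force
  moreover have "Im z > 0" "\<bar>Re z\<bar> \<le> 1 / 2"
    using z by (auto simp: fundamental_domain_def upper_half_plane_def)
  ultimately show ?thesis using z(2) by (intro zero_in_strip) (auto simp: eisenstein_eq_0_iff)
qed

section \<open>From zeros in the strip to zeros in the q-disc\<close>

lemma q_top_zero:
  shows "norm (q_of top_zero) < 1" "q_of top_zero \<noteq> 0" "q_of top_zero \<noteq> cnj (q_of top_zero)"
proof -
  show "norm (q_of top_zero) < 1" using top_zero(2) by (simp add: norm_q_of_less_1)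
  show "q_of top_zero \<noteq> 0" by (simp add: q_of_def)
  \<comment> \<open>Since 0 < Re < 1/2, the argument 2 pi Re lies strictly between 0 and pi; this
    keeps the two poles apart.\<close>
  have "Im (q_of top_zero) = exp (- (2 * pi * Im top_zero)) * sin (2 * pi * Re top_zero)"
    by (simp add: q_of_def Im_exp)
  moreover have "sin (2 * pi * Re top_zero) > 0"
    using top_zero(3,4) by (intro sin_gt_zero) auto
  ultimately have "Im (q_of top_zero) > 0" by simp
  thus "q_of top_zero \<noteq> cnj (q_of top_zero)" by (auto simp: complex_eq_iff)
qed

text \<open>The principal logarithm pulls the punctured disc back to the strip of width 1, and
  smaller modulus means greater height. The centre is not a zero because the constant coefficient is
  1.\<close>

lemma eisenstein_fps_zeros:
  assumes v: "norm v \<le> norm (q_of top_zero)" 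
  shows "eval_fps (eisenstein_fps k) v = 0 \<longleftrightarrow> v = q_of top_zero \<or> v = cnj (q_of top_zero)"
proof
  assume *: "v = q_of top_zero \<or> v = cnj (q_of top_zero)"
  have pos: "Im top_zero > 0" using top_zero(2) by simp
  have "eisenstein k top_zero = 0" using top_zero(5) pos by (simp add: eisenstein_eq_0_iff)
  moreover have "eisenstein k (- cnj top_zero) = 0"
    using top_zero(5) pos lattice_sum_cnj[OF even_k[OF k12 k4], of top_zero]
    by (subst eisenstein_eq_0_iff) auto
  ultimately show "eval_fps (eisenstein_fps k) v = 0"
    using * by (auto simp: eisenstein_def q_of_minus_cnj)
next
  assume 0: "eval_fps (eisenstein_fps k) v = 0"
  have "v \<noteq> 0" using 0 by (auto simp: eval_fps_at_0 eisenstein_fps_def)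
  define w where "w = Ln v / (2 * of_real pi * \<i>)"
  have qw: "q_of w = v" using \<open>v \<noteq> 0\<close> by (simp add: q_of_def w_def)
  have w_eq: "w = (- \<i> / of_real (2 * pi)) * Ln v" by (simp add: w_def field_simps)
  have Re: "Re w = Im (Ln v) / (2 * pi)" unfolding w_eq by (simp add: Re_divide_of_real Im_divide_of_real)
  have "\<bar>Im (Ln v)\<bar> \<le> pi" using mpi_less_Im_Ln[OF \<open>v \<noteq> 0\<close>] Im_Ln_le_pi[OF \<open>v \<noteq> 0\<close>] by simp
  hence "\<bar>Re w\<bar> \<le> 1 / 2" unfolding Re by (simp add: abs_mult field_simps)
  moreover have Im: "Im w \<ge> Im top_zero"
    using v unfolding qw[symmetric] norm_q_of by simp
  hence "Im w > 0" using top_zero(2) by simp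
  hence "lattice_sum k w = 0"
    using 0 qw by (subst eisenstein_eq_0_iff[symmetric]) (auto simp: eisenstein_def)
  ultimately have "w = top_zero \<or> w = - cnj top_zero" using Im by (intro zero_in_strip) auto
  thus "v = q_of top_zero \<or> v = cnj (q_of top_zero)" using qw q_of_minus_cnj by auto
qed

text \<open>By the chain rule, a zero of Theta(E_k) at this point would make the derivative of
  \<open>arc_sum\<close> vanish at \<open>top_angle\<close>, contradicting simplicity.\<close>

lemma theta_eisenstein_top_zero: "theta_eisenstein k (q_of top_zero) \<noteq> 0"
proof
  assume 0: "theta_eisenstein k (q_of top_zero) = 0"
  define t0 where "t0 = complex_of_real (top_angle k)"
  define \<zeta> where "\<zeta> = Polygamma (k - 1) (1 :: complex) / fact (k - 1)"
  have Im: "Im (arc_point k t0) > 0" using top_zero(2) by (simp add: top_zero_def t0_def)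
  have "((\<lambda>z. eval_fps (eisenstein_fps k) (q_of z)) has_field_derivative 0) (at (arc_point k t0))"
    using eval_fps_q_of_has_field_derivative[OF fps_conv_radius_eisenstein Im, of k UNIV] 0
    by (simp add: theta_eisenstein_def top_zero_def t0_def)
  hence 1: "(eisenstein k has_field_derivative 0) (at (arc_point k t0))"
    by (simp add: eisenstein_def[abs_def])
  have D: "(arc_point k has_field_derivative (\<i> * (exp (- \<i> * t0 / of_nat k) * (- \<i> / of_nat k)))) (at t0)"
    unfolding arc_point_def[abs_def] using k12 by (auto intro!: derivative_eq_intros)
  have "((\<lambda>t. \<zeta> * eisenstein k (arc_point k t)) has_field_derivative 0) (at t0)"
    using DERIV_cmult[OF DERIV_chain2[OF 1 D], of \<zeta>] by simp
  hence "(arc_sum k has_field_derivative 0) (at t0)"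
  proof (rule has_field_derivative_transform_within_open[of _ _ _ "ball (of_real pi) (1 / 2)"])
    show "t0 \<in> ball (of_real pi) (1 / 2)"
      using top_angle(4)[OF k12 k4] by (simp add: t0_def dist_norm abs_minus_commute flip: of_real_diff)
    fix t :: complex assume "t \<in> ball (of_real pi) (1 / 2)"
    hence "Im (arc_point k t) > 0" by (intro near_disc_Im_pos[OF k12 k4]) auto
    thus "\<zeta> * eisenstein k (arc_point k t) = arc_sum k t"
      using lattice_sum_eisenstein(1)[of "arc_point k t" k] even_k[OF k12 k4] k12
      by (simp add: arc_sum_def \<zeta>_def)
  qed auto
  thus False using top_angle_simple[OF k12 k4, of 0] by (simp add: t0_def)
qed

end

section \<open>Coefficients of the reciprocal\<close>

lemma has_fps_expansion_simple_pole:
  fixes q c :: complex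
  assumes "q \<noteq> 0"
  shows "(\<lambda>v. c / (v - q)) has_fps_expansion Abs_fps (\<lambda>n. - c / q ^ Suc n)"
proof -
  have inv: "inverse (1 - fps_const (1 / q) * fps_X) = Abs_fps (\<lambda>n. (1 / q) ^ n)"
  proof (rule fps_inverse_unique)
    show "(1 - fps_const (1 / q) * fps_X) * Abs_fps (\<lambda>n. (1 / q) ^ n) = 1"
    proof (rule fps_ext)
      fix n show "fps_nth ((1 - fps_const (1 / q) * fps_X) * Abs_fps (\<lambda>n. (1 / q) ^ n)) n = fps_nth 1 n"
        by (cases n) (simp_all add: left_diff_distrib mult.assoc fps_X_mult_nth)
    qed
  qed
  have "(\<lambda>v. - c / q * inverse (1 - 1 / q * v)) has_fps_expansion
          fps_const (- c / q) * inverse (1 - fps_const (1 / q) * fps_X)"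
    by (intro fps_expansion_intros) simp
  also have "(\<lambda>v. - c / q * inverse (1 - 1 / q * v)) = (\<lambda>v. c / (v - q))"
  proof
    fix v show "- c / q * inverse (1 - 1 / q * v) = c / (v - q)"
      using assms by (cases "v = q") (simp_all add: field_simps)
  qed
  also have "fps_const (- c / q) * inverse (1 - fps_const (1 / q) * fps_X) = Abs_fps (\<lambda>n. - c / q ^ Suc n)"
    unfolding inv by (rule fps_ext) (simp add: power_divide)
  finally show ?thesis .
qed

text \<open>After both zeros are divided out, the cofactor has no zero on the closed disc, hence by
  compactness none on a slightly larger one. Partial fractions leave a function holomorphic there,
  whose coefficients are therefore o(|q|^(-n)); the residues are 1/D and 1/D'.\<close>

lemma inverse_fps_two_poles:
  fixes F :: "complex fps" and q q' D D' :: complex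
  assumes F: "fps_conv_radius F \<ge> 1" "fps_nth F 0 \<noteq> 0"
    and q: "norm q < 1" "norm q' = norm q" "q \<noteq> 0" "q \<noteq> q'"
    and zeros: "\<And>v. norm v \<le> norm q \<Longrightarrow> eval_fps F v = 0 \<longleftrightarrow> v = q \<or> v = q'"
    and D: "(eval_fps F has_field_derivative D) (at q)" "D \<noteq> 0"
    and D': "(eval_fps F has_field_derivative D') (at q')" "D' \<noteq> 0"
  obtains e where "\<And>n. fps_nth (inverse F) n = - (1 / D) / q ^ Suc n - (1 / D') / q' ^ Suc n + e n"
    "(\<lambda>n. e n * q ^ n) \<longlonglongrightarrow> 0"
proof -
  define f where "f = eval_fps F"
  define S where "S = ball (0::complex) 1"
  have S: "open S" "0 \<in> S" "q \<in> S" "q' \<in> S" "interior S = S" using q by (auto simp: S_def)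
  have hol: "f holomorphic_on S"
    unfolding f_def S_def using norm_less_fps_conv_radius[OF _ F(1)]
    by (intro holomorphic_on_eval_fps) auto
  have fq: "f q = 0" "f q' = 0" using zeros[of q] zeros[of q'] q by (auto simp: f_def)
  define \<phi> where "\<phi> = (\<lambda>z. if z = q then deriv f q else (f z - f q) / (z - q))"
  have hol_\<phi>: "\<phi> holomorphic_on S" unfolding \<phi>_def using hol S by (intro pole_lemma) auto
  have \<phi>: "f z = (z - q) * \<phi> z" for z using fq by (simp add: \<phi>_def)
  have \<phi>q': "\<phi> q' = 0" using \<phi>[of q'] fq q(4) by simp
  define \<psi> where "\<psi> = (\<lambda>z. if z = q' then deriv \<phi> q' else (\<phi> z - \<phi> q') / (z - q'))"
  have hol_\<psi>: "\<psi> holomorphic_on S" unfolding \<psi>_def using hol_\<phi> S by (intro pole_lemma) auto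
  have \<psi>: "f z = (z - q) * (z - q') * \<psi> z" for z using \<phi>[of z] \<phi>q' by (simp add: \<psi>_def)
  have deriv_at: "deriv_f = (a - b) * \<psi> a"
    if der: "(f has_field_derivative deriv_f) (at a)" and a: "a \<in> S" 
      and eq: "\<And>z. f z = (z - a) * (z - b) * \<psi> z" for a b deriv_f
  proof -
    obtain \<psi>' where "(\<psi> has_field_derivative \<psi>') (at a)"
      using hol_\<psi> a S(1) by (auto simp: holomorphic_on_open)
    hence "((\<lambda>z. (z - a) * (z - b) * \<psi> z) has_field_derivative (a - b) * \<psi> a) (at a)"
      by (auto intro!: derivative_eq_intros)
    moreover have "f = (\<lambda>z. (z - a) * (z - b) * \<psi> z)" using eq by (rule ext)
    ultimately show ?thesis using der by (simp add: DERIV_unique)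
  qed
  have Dq: "D = (q - q') * \<psi> q"
    using D(1) S \<psi> by (intro deriv_at) (auto simp: f_def)
  have Dq': "D' = (q' - q) * \<psi> q'"
    using D'(1) S \<psi> by (intro deriv_at) (auto simp: f_def mult_ac)
  have nz: "\<psi> v \<noteq> 0" if "norm v \<le> norm q" for v
  proof (cases "v = q \<or> v = q'")
    case True
    thus ?thesis using Dq Dq' D(2) D'(2) by auto
  next
    case False
    thus ?thesis using zeros[OF that] \<psi>[of v] by (auto simp: f_def)
  qed
  obtain r where r: "norm q < r" "r < 1" "\<And>v. norm v < r \<Longrightarrow> \<psi> v \<noteq> 0"
  proof -
    define U where "U = S \<inter> \<psi> -` (- {0})"
    have "open U" unfolding U_def
      using hol_\<psi> S(1) by (intro continuous_open_preimage holomorphic_on_imp_continuous_on) auto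
    moreover have "cball 0 (norm q) \<subseteq> U" using nz q by (auto simp: U_def S_def)
    ultimately obtain e where e: "e > 0" "{x. infdist x (cball 0 (norm q)) \<le> e} \<subseteq> U"
      using compact_in_open_separated[of "cball 0 (norm q)" U] by auto
    define r where "r = min (norm q + e) ((norm q + 1) / 2)"
    have "\<psi> v \<noteq> 0" if v: "norm v < r" for v
    proof -
      have "infdist v (cball 0 (norm q)) \<le> e"
      proof (cases "norm v \<le> norm q")
        case True
        thus ?thesis using e by simp
      next
        case False
        hence v0: "v \<noteq> 0" by auto
        \<comment> \<open>The radial projection of \<open>v\<close> to the circle of radius |q|,
          used to bound the distance of \<open>v\<close> from the closed disc.\<close>
        define u where "u = of_real (norm q / norm v) * v"
        have un: "norm u = norm q" using v0 by (simp add: u_def norm_mult norm_divide)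
        have "v - u = of_real (1 - norm q / norm v) * v" by (simp add: u_def algebra_simps)
        hence du: "dist v u = \<bar>1 - norm q / norm v\<bar> * norm v" 
          by (simp only: dist_norm norm_mult norm_of_real)
        have "infdist v (cball 0 (norm q)) \<le> dist v u" using un by (intro infdist_le) auto
        also note du
        also have "\<bar>1 - norm q / norm v\<bar> = 1 - norm q / norm v" using False v0 by (simp add: divide_le_eq)
        also have "(1 - norm q / norm v) * norm v = norm v - norm q" using v0 by (simp add: left_diff_distrib)
        also have "\<dots> \<le> e" using v by (simp add: r_def)
        finally show ?thesis .
      qed
      thus ?thesis using e by (auto simp: U_def)
    qed
    moreover have "norm q < r" "r < 1" using e q by (auto simp: r_def min_def field_simps)
    ultimately show ?thesis by (intro that[of r]) auto
  qed
  define B where "B = ball (0::complex) r"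
  have r0: "r > 0" using r(1) norm_ge_zero[of q] by linarith
  have B: "open B" "0 \<in> B" "q \<in> B" "q' \<in> B" "interior B = B" "B \<subseteq> S"
    using r q r0 by (auto simp: B_def S_def)
  define \<xi> where "\<xi> = (\<lambda>z. 1 / \<psi> z)"
  have hol_\<xi>: "\<xi> holomorphic_on B"
    unfolding \<xi>_def using hol_\<psi> B r(3) by (intro holomorphic_intros) (auto intro: holomorphic_on_subset simp: B_def)
  define quot where "quot = (\<lambda>a z. if z = a then deriv \<xi> a else (\<xi> z - \<xi> a) / (z - a))"
  have hol_quot: "quot a holomorphic_on B" if "a \<in> B" for a
    unfolding quot_def using hol_\<xi> B that by (intro pole_lemma) auto
  \<comment> \<open>The second divided difference of \<open>\<xi>\<close>: what remains of 1/f once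
    \<open>\<xi>\<close> is replaced by its values at the two poles.\<close>
  define H where "H = (\<lambda>z. (quot q z - quot q' z) / (q - q'))"
  have hol_H: "H holomorphic_on B"
    unfolding H_def using B q by (intro holomorphic_intros hol_quot) auto
  define E where "E = fps_expansion H 0"
  have E: "H has_fps_expansion E"
    unfolding E_def using B(1,2) hol_H by (rule has_fps_expansion_fps_expansion)
  have decomp: "inverse (f z) = (1 / D) / (z - q) + (1 / D') / (z - q') + H z"
    if z: "z \<in> B" "z \<noteq> q" "z \<noteq> q'" for z
  proof -
    have qq: "q - q' \<noteq> 0" "z - q \<noteq> 0" "z - q' \<noteq> 0" "q' - q \<noteq> 0" using q z by auto
    have 1: "1 / D = \<xi> q / (q - q')" "1 / D' = - (\<xi> q' / (q - q'))"
      unfolding Dq Dq' \<xi>_def using qq by (simp_all add: minus_divide_right[symmetric] divide_simps)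
    have "inverse (f z) = \<xi> z / ((z - q) * (z - q'))"
      unfolding \<psi>[of z] \<xi>_def by (simp add: field_simps)
    also have "\<dots> = (\<xi> z / (z - q) - \<xi> z / (z - q')) / (q - q')"
    proof -
      have "x / (a * b) = (x / a - x / b) / (b - a)" if "a \<noteq> 0" "b \<noteq> 0" "b - a \<noteq> 0" for x a b :: complex
      proof -
        have "x / a - x / b = x * (b - a) / (a * b)" using that by (simp add: diff_frac_eq algebra_simps)
        thus ?thesis using that by simp
      qed
      from this[of "z - q" "z - q'" "\<xi> z"] show ?thesis using qq by simp
    qed
    also have "\<xi> z / (z - q) = \<xi> q / (z - q) + quot q z"
      using qq by (simp add: quot_def diff_divide_distrib)
    also have "\<xi> z / (z - q') = \<xi> q' / (z - q') + quot q' z"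
      using qq by (simp add: quot_def diff_divide_distrib)
    finally show ?thesis unfolding 1 H_def by (simp add: diff_divide_distrib add_divide_distrib mult.commute)
  qed
  have "f has_fps_expansion F"
    unfolding f_def by (intro eval_fps_has_fps_expansion less_le_trans[OF _ F(1)]) simp
  hence "(\<lambda>z. inverse (f z)) has_fps_expansion inverse F"
    using F(2) by (rule has_fps_expansion_inverse)
  also have "?this \<longleftrightarrow> (\<lambda>z. (1 / D) / (z - q) + (1 / D') / (z - q') + H z) has_fps_expansion inverse F"
  proof (rule has_fps_expansion_cong)
    have "eventually (\<lambda>z. z \<in> B - {q, q'}) (nhds 0)"
      using B q by (intro eventually_nhds_in_open open_Diff) auto
    thus "eventually (\<lambda>z. inverse (f z) = (1 / D) / (z - q) + (1 / D') / (z - q') + H z) (nhds 0)"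
      by eventually_elim (use decomp in auto)
  qed auto
  finally have "(\<lambda>z. (1 / D) / (z - q) + (1 / D') / (z - q') + H z) has_fps_expansion inverse F" .
  moreover have "(\<lambda>z. (1 / D) / (z - q) + (1 / D') / (z - q') + H z) has_fps_expansion 
      Abs_fps (\<lambda>n. - (1 / D) / q ^ Suc n) + Abs_fps (\<lambda>n. - (1 / D') / q' ^ Suc n) + E"
    using q by (intro has_fps_expansion_add has_fps_expansion_simple_pole E) auto
  ultimately have "inverse F = Abs_fps (\<lambda>n. - (1 / D) / q ^ Suc n) + Abs_fps (\<lambda>n. - (1 / D') / q' ^ Suc n) + E"
    by (rule fps_expansion_unique_complex)
  hence "fps_nth (inverse F) n = - (1 / D) / q ^ Suc n - (1 / D') / q' ^ Suc n + fps_nth E n" for n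
    by simp
  moreover have "(\<lambda>n. fps_nth E n * q ^ n) \<longlonglongrightarrow> 0"
  proof (rule summable_LIMSEQ_zero[OF summable_fps])
    have Er: "fps_conv_radius E \<ge> ereal r"
      unfolding E_def using hol_H by (intro conv_radius_fps_expansion) (simp add: B_def)
    have "ereal (norm q) < ereal r" using r(1) by simp
    thus "ereal (norm q) < fps_conv_radius E" using Er by (rule less_le_trans)
  qed
  ultimately show ?thesis by (rule that)
qed

text \<open>Consecutive values of \<open>c + c' u ^ n\<close> cannot both be small when \<open>u \<noteq> 1\<close>, because
  \<open>(c + c' u ^ Suc n) - u (c + c' u ^ n) = c (1 - u)\<close>.\<close>

lemma infinitely_often_bounded_below:
  fixes c c' u :: complex
  assumes c: "c \<noteq> 0" and u: "norm u = 1" "u \<noteq> 1"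
  obtains \<delta> and m :: "nat \<Rightarrow> nat" where "\<delta> > 0" "strict_mono m" "\<And>t. m t \<ge> 1" "\<And>t. norm (c + c' * u ^ m t) \<ge> \<delta>"
proof -
  define \<delta> where "\<delta> = norm c * norm (1 - u) / 2"
  define N where "N = {n. n \<ge> 1 \<and> norm (c + c' * u ^ n) \<ge> \<delta>}"
  have \<delta>: "\<delta> > 0" using assms by (simp add: \<delta>_def)
  have *: "n \<in> N \<or> Suc n \<in> N" if "n \<ge> 1" for n
  proof -
    have "c * (1 - u) = (c + c' * u ^ Suc n) - u * (c + c' * u ^ n)"
      by (simp add: algebra_simps)
    hence "norm (c * (1 - u)) \<le> norm (c + c' * u ^ Suc n) + norm (u * (c + c' * u ^ n))"
      by (simp only: norm_triangle_ineq4)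
    hence "2 * \<delta> \<le> norm (c + c' * u ^ Suc n) + norm (c + c' * u ^ n)"
      by (simp add: \<delta>_def norm_mult u)
    thus ?thesis using that unfolding N_def by (simp del: power_Suc) linarith
  qed
  have "infinite N"
    unfolding infinite_nat_iff_unbounded_le
  proof
    fix m
    have "Suc m \<in> N \<or> Suc (Suc m) \<in> N" by (rule *) simp
    thus "\<exists>n\<ge>m. n \<in> N"
    proof
      assume "Suc m \<in> N"
      thus ?thesis by (intro exI[of _ "Suc m"]) simp
    next
      assume "Suc (Suc m) \<in> N"
      thus ?thesis by (intro exI[of _ "Suc (Suc m)"]) simp
    qed
  qed
  then obtain m :: "nat \<Rightarrow> nat" where m: "strict_mono m" "\<And>t. m t \<in> N"
    using infinite_enumerate[of N] by auto
  have "m t \<ge> 1" "norm (c + c' * u ^ m t) \<ge> \<delta>" for t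
    using m(2)[of t] unfolding N_def by blast+
  with \<delta> m(1) show ?thesis by (rule that)
qed

section \<open>Conjugation symmetry and the final limit\<close>

lemma eval_fps_cnj:
  assumes F: "\<And>n. fps_nth F n \<in> \<real>" and z: "ereal (norm z) < fps_conv_radius F"
  shows "eval_fps F (cnj z) = cnj (eval_fps F z)"
proof -
  have "(\<lambda>n. cnj (fps_nth F n * z ^ n)) sums cnj (eval_fps F z)"
    using sums_eval_fps[OF z] by (rule sums_cnj[THEN iffD2])
  moreover have "cnj (fps_nth F n * z ^ n) = fps_nth F n * cnj z ^ n" for n
    using F[of n] by (simp add: Reals_cnj_iff)
  ultimately have "(\<lambda>n. fps_nth F n * cnj z ^ n) sums cnj (eval_fps F z)"
    by (simp only:)
  thus ?thesis by (simp add: eval_fps_def[of F "cnj z"] sums_iff)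
qed

theorem theorem5:
  fixes k :: nat and z q :: complex
  assumes "k \<ge> 12" and "k mod 4 = 0"
    and "is_arg_max Im (\<lambda>w. w \<in> fundamental_domain \<and> eisenstein k w = 0) z"
  defines "q \<equiv> q_of z"
  shows "\<exists>n :: nat \<Rightarrow> nat. strict_mono n \<and> (\<forall>t. n t \<ge> 1) \<and>
    (\<lambda>t. inv_eisenstein_coeff k (n t) /
         (- (q powi (- int (n t))) *
            (1 / theta_eisenstein k q +
             1 / theta_eisenstein k (cnj q) * (q / cnj q) ^ n t)))
      \<longlonglongrightarrow> 1"
proof -
  note k = assms(1,2)
  define F where "F = eisenstein_fps k"
  have F: "fps_conv_radius F \<ge> 1" "fps_nth F 0 \<noteq> 0"
    unfolding F_def by (rule fps_conv_radius_eisenstein) (simp add: eisenstein_fps_def)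
  have F_real: "fps_nth F n \<in> \<real>" for n
    by (auto simp: F_def eisenstein_fps_def)
  define q0 where "q0 = q_of (top_zero k)"
  have q_q0: "q = q0 \<or> q = cnj q0"
    using arg_max_zero[OF k assms(3)] by (auto simp: q_def q0_def q_of_minus_cnj)
  have q: "norm q < 1" "q \<noteq> 0" "q \<noteq> cnj q" "norm q = norm q0"
    using q_q0 q_top_zero[OF k] by (auto simp: q0_def)
  have zeros: "eval_fps F v = 0 \<longleftrightarrow> v = q \<or> v = cnj q" if "norm v \<le> norm q" for v
    using eisenstein_fps_zeros[OF k, of v] that q_q0 q(4) by (auto simp: F_def q0_def)
  have less: "ereal (norm v) < fps_conv_radius F" if "norm v = norm q" for v :: complex
    using that q(1) F(1) by (intro norm_less_fps_conv_radius) auto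
  have theta: "theta_eisenstein k v = v * eval_fps (fps_deriv F) v" if "norm v = norm q" for v :: complex
    using less[OF that] by (simp add: theta_eisenstein_def F_def eval_fps_XD)
  have theta_cnj: "theta_eisenstein k (cnj v) = cnj (theta_eisenstein k v)" if "norm v = norm q" for v :: complex
    unfolding theta_eisenstein_def F_def[symmetric]
    using F_real less_le_trans[OF less[OF that] fps_conv_radius_XD]
    by (intro eval_fps_cnj) (auto simp: fps_XD_nth)
  have theta_nz: "theta_eisenstein k q \<noteq> 0" "theta_eisenstein k (cnj q) \<noteq> 0"
    using theta_eisenstein_top_zero[OF k] theta_cnj[of q] theta_cnj[of q0] q_q0 q(4) by (auto simp: q0_def)
  \<comment> \<open>The factor q in Theta = q d/dq absorbs an off-by-one: (1/D)/q^(n+1) equals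
    (1/Theta(E_k)(q))/q^n.\<close>
  define D D' where "D = eval_fps (fps_deriv F) q" and "D' = eval_fps (fps_deriv F) (cnj q)"
  have D: "theta_eisenstein k q = q * D" "theta_eisenstein k (cnj q) = cnj q * D'" "D \<noteq> 0" "D' \<noteq> 0"
    using theta[of q] theta[of "cnj q"] theta_nz by (auto simp: D_def D'_def)
  obtain e where e: "\<And>n. fps_nth (inverse F) n = - (1 / D) / q ^ Suc n - (1 / D') / cnj q ^ Suc n + e n"
    "(\<lambda>n. e n * q ^ n) \<longlonglongrightarrow> 0"
  proof (rule inverse_fps_two_poles[OF F q(1) _ q(2,3) zeros])
    show "(eval_fps F has_field_derivative D) (at q)" "(eval_fps F has_field_derivative D') (at (cnj q))"
      unfolding D_def D'_def using less by (auto intro!: has_field_derivative_eval_fps)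
  qed (use D in auto)
  define c c' u where "c = 1 / theta_eisenstein k q" and "c' = 1 / theta_eisenstein k (cnj q)" and "u = q / cnj q"
  have cu: "c \<noteq> 0" "norm u = 1" "u \<noteq> 1"
    using q theta_nz by (auto simp: c_def u_def norm_divide)
  obtain \<delta> and m :: "nat \<Rightarrow> nat" where m: "\<delta> > 0" "strict_mono m" "\<And>t. m t \<ge> (1::nat)" "\<And>t. norm (c + c' * u ^ m t) \<ge> \<delta>"
    by (rule infinitely_often_bounded_below[OF cu, of c']) (rule that)
  define M where "M = (\<lambda>n. - (q powi (- int n)) * (c + c' * u ^ n))"
  have M: "M n = - (c + c' * u ^ n) / q ^ n" for n
    by (simp add: M_def power_int_minus divide_inverse algebra_simps)
  have coeff: "inv_eisenstein_coeff k n = M n + e n" for n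
  proof -
    have "c' * u ^ n / q ^ n = c' / cnj q ^ n" using q(2) by (simp add: u_def power_divide)
    hence "M n = - (c / q ^ n) - c' / cnj q ^ n" by (simp add: M diff_divide_distrib)
    thus ?thesis using e(1)[of n] by (simp add: inv_eisenstein_coeff_def F_def c_def c'_def D mult_ac)
  qed
  have "(\<lambda>t. e (m t) * q ^ m t) \<longlonglongrightarrow> 0"
    using LIMSEQ_subseq_LIMSEQ[OF e(2) m(2)] by (simp add: o_def)
  hence "(\<lambda>t. norm (e (m t) * q ^ m t) / \<delta>) \<longlonglongrightarrow> 0"
    by (intro tendsto_divide_zero tendsto_norm_zero)
  hence "(\<lambda>t. e (m t) / M (m t)) \<longlonglongrightarrow> 0"
  \<comment> \<open>Along the chosen indices the bracket is at least \<open>\<delta>\<close> in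
    modulus, so the relative error is at most |e_n q^n| / \<open>\<delta>\<close>; the same bound
    keeps the denominator away from 0.\<close>
  proof (rule Lim_null_comparison[rotated])
    have "norm (e n / M n) \<le> norm (e n * q ^ n) / \<delta>" if "norm (c + c' * u ^ n) \<ge> \<delta>" for n
    proof -
      have "norm (e n / M n) = norm (e n * q ^ n) / norm (c + c' * u ^ n)"
      proof -
        have "norm (M n) = norm (c + c' * u ^ n) / norm q ^ n"
          by (simp only: M norm_divide norm_minus_cancel norm_power)
        thus ?thesis by (simp add: norm_divide norm_mult norm_power)
      qed
      also have "\<dots> \<le> norm (e n * q ^ n) / \<delta>" using that m(1) by (intro divide_left_mono mult_pos_pos) auto
      finally show ?thesis .
    qed
    thus "eventually (\<lambda>t. norm (e (m t) / M (m t)) \<le> norm (e (m t) * q ^ m t) / \<delta>) sequentially"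
      using m(4) by simp
  qed
  hence "(\<lambda>t. 1 + e (m t) / M (m t)) \<longlonglongrightarrow> 1 + 0"
    by (intro tendsto_intros)
  moreover have "inv_eisenstein_coeff k (m t) / M (m t) = 1 + e (m t) / M (m t)" for t
  proof -
    have "c + c' * u ^ m t \<noteq> 0" using m(1) m(4)[of t] by auto
    hence "M (m t) \<noteq> 0"
      unfolding M divide_eq_0_iff neg_equal_0_iff_equal using q(2) by simp
    thus ?thesis by (simp add: coeff add_divide_distrib)
  qed
  ultimately have "(\<lambda>t. inv_eisenstein_coeff k (m t) / M (m t)) \<longlonglongrightarrow> 1" by simp
  thus ?thesis using m(2,3) unfolding M_def c_def c'_def u_def by blast
qed

end
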